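(* Let $\Lambda=\Lambda(\Omega)$ be a model set and $Q$ a linear similarity compatible with $\Lambda$, with associated contraction $A=Q^*$ on $\mathbb R^n$, and let $f\in\mathcal C(\Omega)$ be the function on internal space corresponding to the unique $Q$-invariant density $p=p_f\in\mathcal C(\Lambda)$. Let $\{v_1,\dots,v_n\}$ be a basis of $\mathbb C^n$ consisting of eigenvectors of $A^t$, with $A^tv_j=\alpha_jv_j$, let $\{v_1^\dagger,\dots,v_n^\dagger\}$ be the dual basis, and let $\mathrm D_j=v_j^\dagger\cdot\nabla$. Then for every $\boldsymbol b=(b_1,\dots,b_n)\in\mathbb Z_{\ge0}^n$ the partial derivative $$\mathrm D^{\boldsymbol b}f=\mathrm D_1^{b_1}\cdots\mathrm D_n^{b_n}f$$ is an eigenfunction of the refinement operator $\mathcal A$, with eigenvalue $\alpha^{\boldsymbol b}=\alpha_1^{b_1}\cdots\alpha_n^{b_n}$.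
   Context: Cut and project scheme: $\mathbb R^m$ (physical space) and $\mathbb R^n$ (internal space) are Euclidean spaces, $\mathbb R^m\times\mathbb R^n$ is their orthogonal sum, $\pi_1,\pi_2$ are the projections onto $\mathbb R^m$ and $\mathbb R^n$, and $\tilde L\subset\mathbb R^m\times\mathbb R^n$ is a lattice such that $\pi_1|_{\tilde L}$ is injective and $\pi_2(\tilde L)$ is dense in $\mathbb R^n$. Put $L=\pi_1(\tilde L)$ and let $(\,)^*=\pi_2\circ(\pi_1|_{\tilde L})^{-1}:L\to\mathbb R^n$. For $\Omega\subset\mathbb R^n$, $\Lambda(\Omega)=\{x\in L\mid x^*\in\Omega\}$; it is a model set if $\Omega$ is compact, $\Omega=\overline{\mathrm{int}(\Omega)}$, and $\partial\Omega$ has Lebesgue measure $0$. Standing assumptions: $0\in\Lambda$ and $0\in\mathrm{int}(\Omega)$. A linear similarity is $Q=qR$ with $R$ an orthogonal transformation of $\mathbb R^m$ and $q$ real. It is assumed that $QL=L$. Then $Q$ induces an automorphism of the lattice $\tilde L$ and a linear map $A=Q^*$ of $\mathbb R^n$ with $(Qx)^*=A(x^* )$ for $x\in L$; $A$ is diagonalizable over $\mathbb C$, and it is assumed that all its eigenvalues have absolute value less than $1$ (so $0<|\alpha_j|<1$). Define $\Omega_Q=\{u\in\mathbb R^n\mid A\Omega+u\subset\Omega\}$. $Q$ is compatible with $\Lambda$ if $\mathrm{int}(\Omega_Q)\neq\emptyset$. It is always assumed that $\partial\Omega_Q$ has Lebesgue measure $0$. $\mathcal C(\Omega)$ is the space of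 continuous complex-valued functions on $\mathbb R^n$ with support in $\Omega$. The refinement (averaging) operator on $\mathcal C(\Omega)$ is $$(\mathcal Af)(x)=\frac1{|\det(A)|\,\mathrm{vol}(\Omega_Q)}\int_{\Omega_Q}f(A^{-1}(x-u))\,du .$$ The function $f$ of the $Q$-invariant density is the unique element of $\mathcal C(\Omega)$ that is non-negative, satisfies $\mathcal Af=f$ and $\int_{\mathbb R^n}f(u)\,du=1$ (the invariant density itself is $p_f(x)=\mathrm{vol}(\Omega)f(x^* )$ for $x\in\Lambda$, and $0$ on $L\setminus\Lambda$; $\mathcal C(\Lambda)$ is the space of all such functions with $f\in\mathcal C(\Omega)$). Equivalently, $\hat f(k)=\prod_{N=0}^\infty\hat{\mathbf 1}_{\Omega_Q}((A^t)^Nk)/\mathrm{vol}(\Omega_Q)$, where $\hat f(k)=\int_{\mathbb R^n}e^{-2\pi ik\cdot x}f(x)\,dx$; this $f$ is $C^\infty$. The dual basis is defined by $v_i^\dagger\cdot v_j=\delta_{ij}$, where $\cdot$ denotes the bilinear extension to $\mathbb C^n$ of the standard scalar product; $\mathrm D_j=\sum_i (v_j^\dagger)_i\,\partial/\partial x_i$. *)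

theory Defs
  imports "HOL-Analysis.Analysis"
begin

section \<open>Cut and project schemes\<close>

definition is_lattice :: "'a::euclidean_space set \<Rightarrow> bool" where
  "is_lattice \<Gamma> \<longleftrightarrow>
     (\<exists>B. independent B \<and> span B = UNIV \<and>
          \<Gamma> = {\<Sum>b\<in>B. real_of_int (c b) *\<^sub>R b | c :: 'a \<Rightarrow> int. True})"

definition cut_and_project_scheme :: "((real^'m) \<times> (real^'n)) set \<Rightarrow> bool" where
  "cut_and_project_scheme Lt \<longleftrightarrow>
     is_lattice Lt \<and> inj_on fst Lt \<and> closure (snd ` Lt) = UNIV"

text \<open>The physical projection \<open>L\<close> of the lattice \<open>Lt\<close>, and the map
  \<open>( )* = snd o (fst restricted to Lt)^-1\<close>, meaningful on \<open>L\<close> only.\<close>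

definition phys :: "((real^'m) \<times> (real^'n)) set \<Rightarrow> (real^'m) set" where
  "phys Lt = fst ` Lt"

definition star :: "((real^'m) \<times> (real^'n)) set \<Rightarrow> real^'m \<Rightarrow> real^'n" where
  "star Lt x = snd (inv_into Lt fst x)"

definition Lambda :: "((real^'m) \<times> (real^'n)) set \<Rightarrow> (real^'n) set \<Rightarrow> (real^'m) set" where
  "Lambda Lt \<Omega> = {x \<in> phys Lt. star Lt x \<in> \<Omega>}"

text \<open>The conditions on the window \<open>\<Omega>\<close> under which \<open>Lambda Lt \<Omega>\<close> is a model set.\<close>

definition model_set_window :: "(real^'n) set \<Rightarrow> bool" where
  "model_set_window \<Omega> \<longleftrightarrow>
     compact \<Omega> \<and> \<Omega> = closure (interior \<Omega>) \<and> frontier \<Omega> \<in> null_sets lborel"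


section \<open>Linear similarities\<close>

definition linear_similarity :: "real^'m^'m \<Rightarrow> bool" where
  "linear_similarity Q \<longleftrightarrow> (\<exists>q R. orthogonal_matrix R \<and> Q = q *\<^sub>R R)"

text \<open>\<open>A = Q*\<close>: since \<open>star Lt ` phys Lt\<close> is dense, at most one \<open>A\<close> satisfies this.\<close>

definition is_star_of ::
  "((real^'m) \<times> (real^'n)) set \<Rightarrow> real^'n^'n \<Rightarrow> real^'m^'m \<Rightarrow> bool" where
  "is_star_of Lt A Q \<longleftrightarrow> (\<forall>x\<in>phys Lt. star Lt (Q *v x) = A *v star Lt x)"

definition cmat :: "real^'n^'n \<Rightarrow> complex^'n^'n" where
  "cmat A = map_matrix complex_of_real A"

definition eigenvalues_in_unit_disc :: "real^'n^'n \<Rightarrow> bool" where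
  "eigenvalues_in_unit_disc A \<longleftrightarrow>
     (\<forall>z w. w \<noteq> 0 \<and> cmat A *v w = z *s w \<longrightarrow> cmod z < 1)"

definition Omega_Q :: "real^'n^'n \<Rightarrow> (real^'n) set \<Rightarrow> (real^'n) set" where
  "Omega_Q A \<Omega> = {u. (\<lambda>x. A *v x + u) ` \<Omega> \<subseteq> \<Omega>}"

definition compatible :: "real^'n^'n \<Rightarrow> (real^'n) set \<Rightarrow> bool" where
  "compatible A \<Omega> \<longleftrightarrow> interior (Omega_Q A \<Omega>) \<noteq> {}"


section \<open>The refinement operator\<close>

definition C_supp :: "(real^'n) set \<Rightarrow> (real^'n \<Rightarrow> complex) set" where
  "C_supp \<Omega> = {f. continuous_on UNIV f \<and> closure {x. f x \<noteq> 0} \<subseteq> \<Omega>}"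

definition refinement_op ::
  "real^'n^'n \<Rightarrow> (real^'n) set \<Rightarrow> (real^'n \<Rightarrow> complex) \<Rightarrow> real^'n \<Rightarrow> complex" where
  "refinement_op A \<Omega> f x =
     (1 / (\<bar>det A\<bar> * measure lborel (Omega_Q A \<Omega>))) *\<^sub>R
       (LINT u:Omega_Q A \<Omega>|lborel. f (matrix_inv A *v (x - u)))"

text \<open>The properties characterizing, within \<open>C_supp \<Omega>\<close>, the function on internal space
  of the \<open>Q\<close>-invariant density.\<close>

definition is_invariant_density_function ::
  "real^'n^'n \<Rightarrow> (real^'n) set \<Rightarrow> (real^'n \<Rightarrow> complex) \<Rightarrow> bool" where
  "is_invariant_density_function A \<Omega> f \<longleftrightarrow>
     f \<in> C_supp \<Omega> \<and> (\<forall>x. f x \<in> nonneg_Reals) \<and>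
     refinement_op A \<Omega> f = f \<and> (LINT u|lborel. f u) = 1"

definition refinement_eigenfunction ::
  "real^'n^'n \<Rightarrow> (real^'n) set \<Rightarrow> complex \<Rightarrow> (real^'n \<Rightarrow> complex) \<Rightarrow> bool" where
  "refinement_eigenfunction A \<Omega> z g \<longleftrightarrow>
     g \<in> C_supp \<Omega> \<and> g \<noteq> (\<lambda>x. 0) \<and> refinement_op A \<Omega> g = (\<lambda>x. z * g x)"


section \<open>Eigenbases and partial derivatives\<close>

text \<open>The bilinear (not sesquilinear) extension of the scalar product; \<open>inner\<close> on
  \<open>complex^'n\<close> is a different, real-valued form.\<close>

definition bdot :: "complex^'n \<Rightarrow> complex^'n \<Rightarrow> complex" where
  "bdot v w = (\<Sum>i\<in>UNIV. v $ i * w $ i)"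

definition is_cbasis :: "('n \<Rightarrow> complex^'n) \<Rightarrow> bool" where
  "is_cbasis v \<longleftrightarrow> inj v \<and> vec.independent (range v) \<and> vec.span (range v) = UNIV"

definition is_dual_basis :: "('n \<Rightarrow> complex^'n) \<Rightarrow> ('n \<Rightarrow> complex^'n) \<Rightarrow> bool" where
  "is_dual_basis vd v \<longleftrightarrow> (\<forall>i j. bdot (vd i) (v j) = (if i = j then 1 else 0))"

definition partial_deriv :: "'n \<Rightarrow> (real^'n \<Rightarrow> complex) \<Rightarrow> real^'n \<Rightarrow> complex" where
  "partial_deriv i g x = vector_derivative (\<lambda>t::real. g (x + t *\<^sub>R axis i 1)) (at 0)"

text \<open>\<open>C^\<infinity>\<close>: all iterated partial derivatives, \<open>g\<close> included, are differentiable, so that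
  the total function \<open>partial_deriv\<close> is everywhere the true partial derivative.\<close>

definition C_infinity :: "(real^'n \<Rightarrow> complex) \<Rightarrow> bool" where
  "C_infinity g \<longleftrightarrow> (\<forall>is x. foldr partial_deriv is g differentiable (at x))"

definition cdir_deriv :: "complex^'n \<Rightarrow> (real^'n \<Rightarrow> complex) \<Rightarrow> real^'n \<Rightarrow> complex" where
  "cdir_deriv w g x = (\<Sum>i\<in>UNIV. w $ i * partial_deriv i g x)"

text \<open>The coordinates are indexed by a finite type without a preferred order, so the list
  \<open>js\<close> records the order \<open>j1, ..., jn\<close> in which
  \<open>D_j1^(b j1) (... (D_jn^(b jn) g))\<close> is formed.\<close>

definition multi_deriv ::
  "('n \<Rightarrow> complex^'n) \<Rightarrow> 'n list \<Rightarrow> ('n \<Rightarrow> nat) \<Rightarrow> (real^'n \<Rightarrow> complex) \<Rightarrow> real^'n \<Rightarrow> complex"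
  where
  "multi_deriv vd js b g = foldr (\<lambda>j. cdir_deriv (vd j) ^^ b j) js g"

end

theory Submission
  imports Defs "HOL-Complex_Analysis.Cauchy_Integral_Formula"
begin

text \<open>
  The matrix \<open>A\<close> is invertible, since it maps the dense set \<open>snd ` Lt\<close> onto itself. The heart
  of the proof is that every eigenfunction \<open>g\<close> of the refinement operator with eigenvalue
  \<open>z \<noteq> 0\<close> is \<open>C\<^sup>1\<close>; Fourier analysis is replaced by a self-similarity argument. Let \<open>M\<^sub>h\<close> be the
  average over the translates by \<open>t h\<close>, \<open>0 \<le> t \<le> 1\<close>, and \<open>T\<^sub>h = 1 - M\<^sub>h\<^sup>2\<close>. The operator intertwines
  \<open>T\<^sub>h\<close> with \<open>T\<^bsub>A\<inverse>h\<^esub>\<close>, and translations are continuous in \<open>L\<^sup>1\<close>, so each application of the eigenvalue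
  equation absorbs one factor \<open>T\<^sub>h\<close> at the cost of a factor \<open>q\<close>, which is as small as we please once
  \<open>h\<close> is small. Hence \<open>T\<^sub>h\<^sup>N g = O(q\<^sup>N)\<close> for \<open>h\<close> of length about \<open>\<kappa>\<^sup>-\<^sup>N\<close>, with \<open>\<kappa>\<close> fixed. On the
  other hand, \<open>g - T\<^sub>h\<^sup>N g\<close> has the factor \<open>M\<^sub>h\<^sup>2\<close> and so a Lipschitz derivative along \<open>h\<close> with
  constant growing at most exponentially in \<open>N\<close>. Interpolating between the two bounds shows that
  the derivatives of these approximations converge uniformly.

  Differentiating the eigenvalue equation along an eigenvector of \<open>A\<close> multiplies \<open>z\<close> by the
  eigenvalue. So partial derivatives of eigenfunctions are combinations of eigenfunctions, which
  gives smoothness. If \<open>D\<^sub>j g = 0\<close>, then \<open>g\<close> is bounded and entire along the image of \<open>\<complex>\<close> under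
  \<open>s + \<i>t \<mapsto> x + s Re v\<^sub>j\<^sup>\<dagger> + t Im v\<^sub>j\<^sup>\<dagger>\<close>, hence constant there, and it vanishes far out.
\<close>

section \<open>Averages along segments\<close>

definition avg :: "'a::real_normed_vector \<Rightarrow> ('a \<Rightarrow> complex) \<Rightarrow> 'a \<Rightarrow> complex" where
  "avg h F x = integral {0..1} (\<lambda>t. F (x - t *\<^sub>R h))"

text \<open>The average is taken twice because, for bounded continuous \<open>F\<close>,
  \<open>avg h (avg h F)\<close> has a Lipschitz derivative along \<open>h\<close>; for a single
  average that derivative is only continuous.\<close>

definition avg_defect :: "'a::real_normed_vector \<Rightarrow> ('a \<Rightarrow> complex) \<Rightarrow> 'a \<Rightarrow> complex" where
  "avg_defect h F x = F x - avg h (avg h F) x"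

lemma continuous_on_compose_UNIV:
  fixes F :: "'a::real_normed_vector \<Rightarrow> 'b::topological_space"
  assumes "continuous_on UNIV F" "continuous_on S g"
  shows "continuous_on S (\<lambda>t. F (g t))"
  using continuous_on_compose2[OF assms] by simp

lemma continuous_on_avg:
  assumes "continuous_on UNIV F"
  shows "continuous_on UNIV (avg h F)"
proof -
  have "continuous_on (UNIV \<times> cbox 0 1) (\<lambda>(x, t). F (x - t *\<^sub>R h))"
    unfolding case_prod_beta by (intro continuous_on_compose_UNIV[OF assms] continuous_intros)
  from integral_continuous_on_param[OF this] show ?thesis
    by (simp add: avg_def[abs_def] box_real)
qed

lemma continuous_on_avg_defect:
  assumes "continuous_on UNIV F"
  shows "continuous_on UNIV (avg_defect h F)"
  unfolding avg_defect_def[abs_def]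
  by (intro continuous_intros continuous_on_avg assms)

lemma norm_avg_le:
  assumes "continuous_on UNIV F" "\<And>t. t \<in> {0..1} \<Longrightarrow> norm (F (x - t *\<^sub>R h)) \<le> B"
  shows "norm (avg h F x) \<le> B"
proof -
  have "norm (integral {0..1} (\<lambda>t. F (x - t *\<^sub>R h))) \<le> B * (1 - 0)"
    by (rule integral_bound)
      (use assms(2) in \<open>auto intro!: continuous_intros continuous_on_compose_UNIV[OF assms(1)]\<close>)
  then show ?thesis by (simp add: avg_def)
qed

lemma norm_diff_avg_le:
  assumes "continuous_on UNIV F" "\<And>t. t \<in> {0..1} \<Longrightarrow> norm (F x - F (x - t *\<^sub>R h)) \<le> B"
  shows "norm (F x - avg h F x) \<le> B"
proof -
  have cont: "continuous_on {0..1} (\<lambda>t. F (x - t *\<^sub>R h))"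
    by (intro continuous_intros continuous_on_compose_UNIV[OF assms(1)])
  have "norm (integral {0..1} (\<lambda>t. F x - F (x - t *\<^sub>R h))) \<le> B * (1 - 0)"
    by (rule integral_bound) (use assms(2) in \<open>auto intro!: continuous_intros cont\<close>)
  also have "integral {0..1} (\<lambda>t. F x - F (x - t *\<^sub>R h)) = F x - avg h F x"
    using cont by (subst integral_diff) (auto simp: avg_def integrable_continuous_real)
  finally show ?thesis by simp
qed

lemma norm_avg_defect_le:
  assumes "continuous_on UNIV F" "\<And>x. norm (F x) \<le> B"
  shows "norm (avg_defect h F x) \<le> 2 * B"
proof -
  have "norm (avg h (avg h F) x) \<le> B"
    by (intro norm_avg_le continuous_on_avg assms)
  then show ?thesis
    unfolding avg_defect_def using norm_triangle_ineq4[of "F x" "avg h (avg h F) x"] assms(2)[of x]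
    by simp
qed

text \<open>With \<open>M\<close> the average along \<open>h\<close>,
  \<open>1 - M^2 = (1 - M) + M (1 - M)\<close>, and each summand is bounded by the oscillation of
  \<open>F\<close> along segments.\<close>

lemma norm_avg_defect_le_oscillation:
  assumes cont: "continuous_on UNIV F"
    and osc: "\<And>x t. t \<in> {0..1} \<Longrightarrow> norm (F x - F (x - t *\<^sub>R h)) \<le> B"
  shows "norm (avg_defect h F x) \<le> 2 * B"
proof -
  have 1: "norm (F y - avg h F y) \<le> B" for y
    by (intro norm_diff_avg_le cont osc)
  have "norm (avg h F x - avg h (avg h F) x) = norm (avg h (\<lambda>y. F y - avg h F y) x)"
    unfolding avg_def[of h "\<lambda>y. F y - avg h F y"]
    by (subst integral_diff)
      (auto simp: avg_def[of h "avg h F"] avg_def[of h F x]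
        intro!: integrable_continuous_real continuous_on_compose_UNIV[OF cont]
          continuous_on_compose_UNIV[OF continuous_on_avg[OF cont]] continuous_intros)
  also have "\<dots> \<le> B"
    by (intro norm_avg_le continuous_intros cont continuous_on_avg 1)
  finally show ?thesis
    unfolding avg_defect_def
    using 1[of x] norm_triangle_ineq[of "F x - avg h F x" "avg h F x - avg h (avg h F) x"] by simp
qed

text \<open>By the substitution \<open>u = s - t\<close>, the average on the line through
  \<open>x\<close> is \<open>\<Phi> s - \<Phi> (s - 1)\<close> for an antiderivative
  \<open>\<Phi>\<close> of \<open>F\<close> along that line.\<close>

lemma avg_has_vector_derivative:
  assumes cont: "continuous_on UNIV F"
  shows "((\<lambda>s. avg h F (x + s *\<^sub>R h)) has_vector_derivative
           F (x + s *\<^sub>R h) - F (x + s *\<^sub>R h - h)) (at s)"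
proof -
  define \<phi> where "\<phi> u = F (x + u *\<^sub>R h)" for u
  \<comment> \<open>The interval has to contain, in its interior, all \<open>s' - t\<close> with
    \<open>s'\<close> within distance 1 of \<open>s\<close> and \<open>t\<close> between 0 and 1;
    half-width 3 leaves room.\<close>
  have "continuous_on {s - 3..s + 3} \<phi>"
    unfolding \<phi>_def by (intro continuous_on_compose_UNIV[OF cont] continuous_intros)
  then obtain \<Phi> where \<Phi>: "\<And>u. u \<in> {s - 3..s + 3} \<Longrightarrow>
      (\<Phi> has_vector_derivative \<phi> u) (at u within {s - 3..s + 3})"
    using antiderivative_continuous by blast
  have \<Phi>': "(\<Phi> has_vector_derivative \<phi> u) (at u)" if "u \<in> {s - 3<..<s + 3}" for u
    using \<Phi>[of u] that at_within_interior[of u "{s - 3..s + 3}"] by simp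
  have avg_eq: "\<Phi> s' - \<Phi> (s' - 1) = avg h F (x + s' *\<^sub>R h)" if "s' \<in> {s - 1<..<s + 1}" for s'
  proof -
    have "((\<lambda>t. \<phi> (s' - t)) has_integral (- \<Phi> (s' - 1) - (- \<Phi> (s' - 0)))) {0..1}"
    proof (rule fundamental_theorem_of_calculus)
      fix t :: real assume t: "t \<in> {0..1}"
      have "(\<Phi> \<circ> (\<lambda>t. s' - t) has_vector_derivative (-1) *\<^sub>R \<phi> (s' - t)) (at t)"
        by (rule vector_diff_chain_at)
          (use t that in \<open>auto intro!: derivative_eq_intros \<Phi>'\<close>)
      then have "((\<lambda>t. - \<Phi> (s' - t)) has_vector_derivative \<phi> (s' - t)) (at t)"
        by (auto intro!: derivative_eq_intros simp: o_def)
      then show "((\<lambda>t. - \<Phi> (s' - t)) has_vector_derivative \<phi> (s' - t)) (at t within {0..1})"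
        by (rule has_vector_derivative_at_within)
    qed simp
    then show ?thesis
      unfolding avg_def \<phi>_def by (auto dest!: integral_unique simp: algebra_simps)
  qed
  have "(\<Phi> \<circ> (\<lambda>s. s - 1) has_vector_derivative 1 *\<^sub>R \<phi> (s - 1)) (at s)"
    by (rule vector_diff_chain_at) (auto intro!: derivative_eq_intros \<Phi>')
  then have "((\<lambda>s'. \<Phi> s' - \<Phi> (s' - 1)) has_vector_derivative \<phi> s - \<phi> (s - 1)) (at s)"
    by (intro has_vector_derivative_diff \<Phi>') (auto simp: o_def)
  then have "((\<lambda>s'. avg h F (x + s' *\<^sub>R h)) has_vector_derivative \<phi> s - \<phi> (s - 1)) (at s)"
    by (rule has_vector_derivative_transform_within_open[where S = "{s - 1<..<s + 1}"])
      (auto simp: avg_eq)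
  then show ?thesis by (simp add: \<phi>_def algebra_simps)
qed

lemma avg_Lipschitz_along:
  assumes cont: "continuous_on UNIV F" and bdd: "\<And>x. norm (F x) \<le> B"
  shows "norm (avg h F (x + s *\<^sub>R h) - avg h F x) \<le> 2 * B * \<bar>s\<bar>"
proof -
  have "norm ((\<lambda>s. avg h F (x + s *\<^sub>R h)) s - (\<lambda>s. avg h F (x + s *\<^sub>R h)) 0) \<le> 2 * B * norm (s - 0)"
  proof (rule differentiable_bound[of UNIV])
    fix u :: real
    show "((\<lambda>s. avg h F (x + s *\<^sub>R h)) has_derivative
        (\<lambda>t. t *\<^sub>R (F (x + u *\<^sub>R h) - F (x + u *\<^sub>R h - h)))) (at u within UNIV)"
      using avg_has_vector_derivative[OF cont] by (simp add: has_vector_derivative_def)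
    have "norm (F (x + u *\<^sub>R h) - F (x + u *\<^sub>R h - h)) \<le> 2 * B"
      using norm_triangle_ineq4[of "F (x + u *\<^sub>R h)" "F (x + u *\<^sub>R h - h)"]
        bdd[of "x + u *\<^sub>R h"] bdd[of "x + u *\<^sub>R h - h"] by linarith
    then show "onorm (\<lambda>t. t *\<^sub>R (F (x + u *\<^sub>R h) - F (x + u *\<^sub>R h - h))) \<le> 2 * B"
      by (intro onorm_le) (simp add: mult_left_mono mult.commute)
  qed auto
  then show ?thesis by simp
qed

section \<open>Integral operators over a compact set\<close>

text \<open>Both \<open>K\<close> and its translate by a short \<open>w\<close> lie in a closed
  neighbourhood of \<open>K\<close>. The measures of these neighbourhoods decrease to that of
  \<open>K\<close>, because \<open>K\<close> is compact, so the symmetric difference is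
  small.\<close>

lemma L1_continuity_of_translation:
  fixes K :: "'a::euclidean_space set"
  assumes "compact K" "\<epsilon> > 0"
  shows "\<exists>\<delta>>0. \<forall>w. norm w \<le> \<delta> \<longrightarrow>
           (LINT u|lborel. \<bar>indicator K (u - w) - indicator K u\<bar>) \<le> (\<epsilon>::real)"
proof (cases "K = {}")
  case True
  then show ?thesis using assms by (auto intro!: exI[of _ 1])
next
  case False
  define N where "N n = {x. infdist x K \<le> 1 / real (Suc n)}" for n
  have cN: "compact (N n)" for n
    unfolding N_def using False assms by (intro compact_infdist_le) auto
  have "(\<Inter>n. N n) = K"
  proof -
    have "x \<in> K" if "\<And>n. infdist x K \<le> 1 / real (Suc n)" for x
    proof -
      have "(\<lambda>n. 1 / real (Suc n)) \<longlonglongrightarrow> 0"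
        using LIMSEQ_inverse_real_of_nat by (simp add: inverse_eq_divide)
      then have "infdist x K \<le> 0"
        by (rule LIMSEQ_le_const) (use that in auto)
      then show ?thesis
        using in_closed_iff_infdist_zero[of K x] False assms infdist_nonneg[of x K]
        by (auto simp: compact_imp_closed)
    qed
    then show ?thesis by (force simp: N_def)
  qed
  moreover have "(\<lambda>n. measure lborel (N n)) \<longlonglongrightarrow> measure lborel (\<Inter>n. N n)"
  proof (rule Lim_measure_decseq)
    show "range N \<subseteq> sets lborel" using cN by (auto simp: borel_compact)
    show "decseq N"
      unfolding decseq_def N_def by (auto simp: frac_le elim!: order_trans)
    show "emeasure lborel (N i) \<noteq> \<infinity>" for i
      using emeasure_compact_finite[OF cN] by (auto simp: less_top)
  qed
  ultimately have "(\<lambda>n. measure lborel (N n)) \<longlonglongrightarrow> measure lborel K" by simp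
  then obtain n where n: "\<bar>measure lborel (N n) - measure lborel K\<bar> < \<epsilon> / 2"
    using assms(2) by (fastforce simp: LIMSEQ_iff dest!: spec[of _ "\<epsilon>/2"])
  have int: "integrable lborel (indicator S :: 'a \<Rightarrow> real)" if "compact S" for S
    using that emeasure_compact_finite[OF that]
    by (intro integrable_real_indicator) (auto simp: borel_compact)
  have tr: "indicator K (u - w) = indicator ((+) w ` K) u" for u w
    by (auto simp: indicator_def image_iff algebra_simps intro!: bexI[of _ "u - w"])
  have "(LINT u|lborel. \<bar>indicator K (u - w) - indicator K u :: real\<bar>) \<le> \<epsilon>"
    if "norm w \<le> 1 / real (Suc n)" for w
  proof -
    let ?L = "(+) w ` K"
    have cL: "compact ?L" using assms(1) by (rule compact_translation)
    have KN: "K \<subseteq> N n"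
      by (auto simp: N_def)
    have "infdist (w + x) K \<le> 1 / real (Suc n)" if "x \<in> K" for x
      using infdist_le[OF that, of "w + x"] \<open>norm w \<le> _\<close> by (simp add: dist_norm)
    then have LN: "?L \<subseteq> N n"
      by (auto simp: N_def)
    \<comment> \<open>The symmetric difference is covered by the two parts of \<open>N n\<close>
      outside \<open>?L\<close> and outside \<open>K\<close>. They have equal measure by translation
      invariance, hence the \<open>\<epsilon> / 2\<close> in the choice of \<open>n\<close>.\<close>
    have ptw: "\<bar>indicator ?L u - indicator K u :: real\<bar>
        \<le> (indicator (N n) u - indicator ?L u) + (indicator (N n) u - indicator K u)" for u
      using KN LN by (auto simp: indicator_def)
    have "(LINT u|lborel. \<bar>indicator K (u - w) - indicator K u :: real\<bar>)
        \<le> (LINT u|lborel. (indicator (N n) u - indicator ?L u) + (indicator (N n) u - indicator K u))"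
      unfolding tr
      by (intro integral_mono integrable_abs Bochner_Integration.integrable_add
          Bochner_Integration.integrable_diff int cN cL assms(1) ptw)
    also have "\<dots> = (measure lborel (N n) - measure lborel ?L) + (measure lborel (N n) - measure lborel K)"
      using int[OF cN] int[OF cL] int[OF assms(1)] by simp
    also have "measure lborel ?L = measure lborel K"
      using measure_translation[of w K] cL assms(1)
      by (simp add: borel_compact)
    finally show ?thesis
      using n abs_ge_self[of "measure lborel (N n) - measure lborel K"] by linarith
  qed
  then show ?thesis by (intro exI[of _ "1 / real (Suc n)"]) auto
qed

text \<open>The refinement operator with its data made arbitrary. The factor is complex so that
  dividing by an eigenvalue turns an eigenvalue equation into a fixed-point equation.\<close>

definition ref_int ::
  "complex \<Rightarrow> 'a::euclidean_space set \<Rightarrow> ('a \<Rightarrow> 'a) \<Rightarrow> ('a \<Rightarrow> complex) \<Rightarrow> 'a \<Rightarrow> complex" where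
  "ref_int c K B F x = c * (LINT u:K|lborel. F (B (x - u)))"

lemma continuous_on_linear_compose:
  fixes B :: "'a::euclidean_space \<Rightarrow> 'b::real_normed_vector" and F :: "'b \<Rightarrow> 'c::topological_space"
  assumes "linear B" "continuous_on UNIV F"
  shows "continuous_on UNIV (\<lambda>u. F (B (x - u)))"
  by (intro continuous_on_compose_UNIV[OF assms(2)] linear_continuous_on_compose[OF _ assms(1)]
      continuous_intros)

lemma set_integrable_compact:
  fixes F :: "'a::euclidean_space \<Rightarrow> 'b::{banach, second_countable_topology}"
  assumes "compact K" "continuous_on UNIV F"
  shows "set_integrable lborel K F"
  using borel_integrable_compact[OF assms(1) continuous_on_subset[OF assms(2)]]
  by (simp add: set_integrable_def)

lemma set_integral_swap_compact:
  fixes G :: "'a::euclidean_space \<Rightarrow> 'b::euclidean_space \<Rightarrow> complex"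
  assumes "compact S" "compact K" "continuous_on UNIV (case_prod G)"
  shows "(LINT t:S|lborel. (LINT u:K|lborel. G t u)) = (LINT u:K|lborel. (LINT t:S|lborel. G t u))"
proof -
  let ?f = "\<lambda>u t. indicator (S \<times> K) (t, u) *\<^sub>R G t u"
  have "integrable lborel (\<lambda>p. indicator (S \<times> K) p *\<^sub>R case_prod G p)"
    using assms by (intro borel_integrable_compact compact_Times) (auto intro: continuous_on_subset)
  then have "integrable (lborel \<Otimes>\<^sub>M lborel) (\<lambda>(t, u). ?f u t)"
    by (simp add: lborel_prod case_prod_beta')
  then have "integrable (lborel \<Otimes>\<^sub>M lborel) (case_prod ?f)"
    by (rule lborel_pair.integrable_product_swap[where f = "\<lambda>(t, u). ?f u t", simplified])
  then have "(LINT t|lborel. LINT u|lborel. ?f u t) = (LINT u|lborel. LINT t|lborel. ?f u t)"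
    by (rule lborel_pair.Fubini_integral)
  moreover have "(LINT t:S|lborel. (LINT u:K|lborel. G t u)) = (LINT t|lborel. LINT u|lborel. ?f u t)"
    unfolding set_lebesgue_integral_def integral_scaleR_right[symmetric]
    by (intro Bochner_Integration.integral_cong) (auto simp: indicator_def)
  moreover have "(LINT u:K|lborel. (LINT t:S|lborel. G t u)) = (LINT u|lborel. LINT t|lborel. ?f u t)"
    unfolding set_lebesgue_integral_def integral_scaleR_right[symmetric]
    by (intro Bochner_Integration.integral_cong) (auto simp: indicator_def)
  ultimately show ?thesis by simp
qed

text \<open>\<open>avg\<close> is a gauge integral and \<open>ref_int\<close> a Lebesgue integral;
  this form makes Fubini applicable to both together.\<close>

lemma avg_eq_set_integral:
  assumes "continuous_on UNIV F"
  shows "avg h F x = (LINT t:{0..1}|lborel. F (x - t *\<^sub>R h))"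
  unfolding avg_def
  by (intro set_borel_integral_eq_integral(2)[symmetric] set_integrable_compact
      continuous_on_compose_UNIV[OF assms] continuous_intros) auto

text \<open>A substitution moves the shift by \<open>w\<close> from the argument of \<open>F\<close>
  to the indicator of \<open>K\<close>. The modulus of continuity thus comes from \<open>K\<close>,
  and \<open>F\<close> enters the estimate only through its bound \<open>M\<close>.\<close>

lemma ref_int_translate_le:
  assumes K: "compact K" and B: "linear B"
    and F: "continuous_on UNIV F" "\<And>x. norm (F x) \<le> M"
  shows "norm (ref_int c K B F (x - w) - ref_int c K B F x)
      \<le> cmod c * (LINT u|lborel. \<bar>indicator K (u - w) - indicator K u\<bar>) * M"
proof -
  let ?k = "indicator K :: 'a \<Rightarrow> real"
  let ?G = "\<lambda>u. F (B (x - u))"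
  have Kb [measurable]: "K \<in> sets borel" using K by (rule borel_compact)
  have [measurable]: "?G \<in> borel_measurable borel"
    by (intro borel_measurable_continuous_onI continuous_on_linear_compose B F)
  have i1: "integrable lborel (\<lambda>u. ?k u *\<^sub>R ?G u)"
    using K by (intro borel_integrable_compact continuous_on_subset[OF continuous_on_linear_compose[OF B F(1)]]) auto
  have tr: "?k (u - w) = indicator ((+) w ` K) u" for u
    by (auto simp: indicator_def image_iff algebra_simps intro!: bexI[of _ "u - w"])
  have cL: "compact ((+) w ` K)" using K by (rule compact_translation)
  have i2: "integrable lborel (\<lambda>u. ?k (u - w) *\<^sub>R ?G u)"
    unfolding tr using cL
    by (intro borel_integrable_compact continuous_on_subset[OF continuous_on_linear_compose[OF B F(1)]]) auto
  have i3: "integrable lborel (\<lambda>u. ?k (u - w) - ?k u)"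
    unfolding tr using cL K emeasure_compact_finite[OF K] emeasure_compact_finite[OF cL]
    by (intro Bochner_Integration.integrable_diff integrable_real_indicator) (auto simp: borel_compact)
  have "(LINT u:K|lborel. F (B (x - w - u)))
      = (LINT u|lborel. ?k (w + u - w) *\<^sub>R ?G (w + u))"
    by (simp add: set_lebesgue_integral_def algebra_simps)
  also have "\<dots> = (LINT u|distr lborel borel ((+) w). ?k (u - w) *\<^sub>R ?G u)"
    by (rule integral_distr[symmetric]) measurable
  finally have "(LINT u:K|lborel. F (B (x - w - u))) = (LINT u|lborel. ?k (u - w) *\<^sub>R ?G u)"
    by (simp add: lborel_distr_plus)
  then have "ref_int c K B F (x - w) - ref_int c K B F x
      = c * (LINT u|lborel. (?k (u - w) - ?k u) *\<^sub>R ?G u)"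
    using i1 i2 unfolding ref_int_def set_lebesgue_integral_def
    by (simp add: scaleR_diff_left right_diff_distrib)
  also have "norm \<dots> = cmod c * norm (LINT u|lborel. (?k (u - w) - ?k u) *\<^sub>R ?G u)"
    by (simp add: norm_mult)
  also have "norm (LINT u|lborel. (?k (u - w) - ?k u) *\<^sub>R ?G u)
      \<le> (LINT u|lborel. \<bar>?k (u - w) - ?k u\<bar> * M)"
  proof (rule Bochner_Integration.integral_norm_bound_integral)
    show "integrable lborel (\<lambda>u. (?k (u - w) - ?k u) *\<^sub>R ?G u)"
      using i1 i2 by (simp add: scaleR_diff_left)
    show "integrable lborel (\<lambda>u. \<bar>?k (u - w) - ?k u\<bar> * M)"
      using i3 by simp
    show "norm ((?k (u - w) - ?k u) *\<^sub>R ?G u) \<le> \<bar>?k (u - w) - ?k u\<bar> * M" for u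
      unfolding norm_scaleR by (intro mult_left_mono F) simp
  qed
  finally show ?thesis by (simp add: mult_left_mono mult.assoc)
qed

lemma continuous_on_ref_int:
  assumes K: "compact K" and B: "linear B"
    and F: "continuous_on UNIV F" "\<And>x. norm (F x) \<le> M"
  shows "continuous_on UNIV (ref_int c K B F)"
  unfolding continuous_on_iff
proof (intro ballI allI impI)
  fix x :: 'a and \<epsilon> :: real assume "\<epsilon> > 0"
  have M: "M \<ge> 0" using F(2)[of 0] norm_ge_zero order_trans by blast
  \<comment> \<open>Adding 1 keeps the divisor positive when \<open>c\<close> or \<open>M\<close> is
    zero.\<close>
  define X where "X = cmod c * M + 1"
  have X: "X > 0" "cmod c * M \<le> X" using M by (auto simp: X_def intro: add_nonneg_pos)
  define \<eta> where "\<eta> = \<epsilon> / (2 * X)"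
  have "\<eta> > 0" using X \<open>\<epsilon> > 0\<close> by (simp add: \<eta>_def)
  from L1_continuity_of_translation[OF K this] obtain \<delta> where "\<delta> > 0" and
    \<delta>: "\<And>w. norm w \<le> \<delta> \<Longrightarrow> (LINT u|lborel. \<bar>indicator K (u - w) - indicator K u\<bar>) \<le> \<eta>"
    by blast
  have "dist (ref_int c K B F y) (ref_int c K B F x) < \<epsilon>" if "dist y x < \<delta>" for y
  proof -
    have "norm (ref_int c K B F (x - (x - y)) - ref_int c K B F x)
        \<le> cmod c * (LINT u|lborel. \<bar>indicator K (u - (x - y)) - indicator K u\<bar>) * M"
      by (rule ref_int_translate_le[OF assms])
    also have "\<dots> \<le> cmod c * \<eta> * M"
      using that M by (intro mult_right_mono mult_left_mono \<delta>) (auto simp: dist_norm norm_minus_commute)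
    also have "\<dots> = (cmod c * M) * \<eta>" by simp
    also have "\<dots> \<le> X * \<eta>" using \<open>\<eta> > 0\<close> X by (intro mult_right_mono) auto
    also have "\<dots> = \<epsilon> / 2" using X by (simp add: \<eta>_def)
    also have "\<dots> < \<epsilon>" using \<open>\<epsilon> > 0\<close> by simp
    finally show ?thesis by (simp add: dist_norm)
  qed
  then show "\<exists>d>0. \<forall>x'\<in>UNIV. dist x' x < d \<longrightarrow> dist (ref_int c K B F x') (ref_int c K B F x) < \<epsilon>"
    using \<open>\<delta> > 0\<close> by blast
qed

text \<open>By Fubini the average passes under the integral over \<open>K\<close>; the linear map
  \<open>B\<close> carries the segment along \<open>h\<close> to one along
  \<open>B h\<close>.\<close>

lemma avg_ref_int:
  assumes K: "compact K" and B: "linear B"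
    and F: "continuous_on UNIV F" "\<And>x. norm (F x) \<le> M"
  shows "avg h (ref_int c K B F) = ref_int c K B (avg (B h) F)"
proof
  fix x
  have shift: "B (x - t *\<^sub>R h - u) = B (x - u) - t *\<^sub>R B h" for t u
    by (simp add: linear_diff[OF B] linear_cmul[OF B])
  have cont: "continuous_on UNIV (\<lambda>(t::real, u). F (B (x - u) - t *\<^sub>R B h))"
    unfolding case_prod_beta
    by (intro continuous_on_compose_UNIV[OF F(1)] linear_continuous_on_compose[OF _ B]
      continuous_intros)
  have "avg h (ref_int c K B F) x
      = (LINT t:{0..1}|lborel. c * (LINT u:K|lborel. F (B (x - u) - t *\<^sub>R B h)))"
    unfolding avg_eq_set_integral[OF continuous_on_ref_int[OF assms]] ref_int_def shift ..
  also have "\<dots> = c * (LINT t:{0..1}|lborel. (LINT u:K|lborel. F (B (x - u) - t *\<^sub>R B h)))"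
    by (rule set_integral_mult_right)
  also have "(LINT t:{0..1}|lborel. (LINT u:K|lborel. F (B (x - u) - t *\<^sub>R B h)))
      = (LINT u:K|lborel. (LINT t:{0..1}|lborel. F (B (x - u) - t *\<^sub>R B h)))"
    by (rule set_integral_swap_compact[OF _ K cont]) auto
  also have "c * \<dots> = ref_int c K B (avg (B h) F) x"
    unfolding ref_int_def avg_eq_set_integral[OF F(1)] ..
  finally show "avg h (ref_int c K B F) x = ref_int c K B (avg (B h) F) x" .
qed

lemma ref_int_diff:
  assumes K: "compact K" and B: "linear B"
    and F: "continuous_on UNIV F" and G: "continuous_on UNIV G"
  shows "ref_int c K B (\<lambda>x. F x - G x) x = ref_int c K B F x - ref_int c K B G x"
  unfolding ref_int_def
  by (simp add: set_integral_diff set_integrable_compact[OF K continuous_on_linear_compose[OF B]] F G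
      right_diff_distrib)

lemma avg_defect_ref_int:
  assumes K: "compact K" and B: "linear B"
    and F: "continuous_on UNIV F" "\<And>x. norm (F x) \<le> M"
  shows "avg_defect h (ref_int c K B F) = ref_int c K B (avg_defect (B h) F)"
proof
  fix x
  have cont: "continuous_on UNIV (avg (B h) F)" "continuous_on UNIV (avg (B h) (avg (B h) F))"
    by (intro continuous_on_avg F)+
  have bdd: "norm (avg (B h) F x) \<le> M" for x
    by (intro norm_avg_le F)
  show "avg_defect h (ref_int c K B F) x = ref_int c K B (avg_defect (B h) F) x"
    unfolding avg_defect_def avg_ref_int[OF K B F] avg_ref_int[OF K B cont(1) bdd]
    by (rule ref_int_diff[symmetric, OF K B F(1) cont(2)])
qed

section \<open>Iterated defects and their decay on fixed points\<close>

lemma continuous_on_avg_defect_pow: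
  assumes "continuous_on UNIV F"
  shows "continuous_on UNIV ((avg_defect h ^^ N) F)"
  by (induction N) (auto intro: continuous_on_avg_defect assms)

lemma norm_avg_defect_pow_le:
  assumes "continuous_on UNIV F" "\<And>x. norm (F x) \<le> M"
  shows "norm ((avg_defect h ^^ N) F x) \<le> 2 ^ N * M"
proof (induction N arbitrary: x)
  case (Suc N)
  have "norm (avg_defect h ((avg_defect h ^^ N) F) x) \<le> 2 * (2 ^ N * M)"
    by (intro norm_avg_defect_le continuous_on_avg_defect_pow assms Suc)
  then show ?case by simp
qed (use assms in auto)

lemma avg_defect_pow_ref_int:
  assumes K: "compact K" and B: "linear B"
    and F: "continuous_on UNIV F" "\<And>x. norm (F x) \<le> M"
  shows "(avg_defect h ^^ N) (ref_int c K B F) = ref_int c K B ((avg_defect (B h) ^^ N) F)"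
proof (induction N)
  case (Suc N)
  have "avg_defect h (ref_int c K B ((avg_defect (B h) ^^ N) F))
      = ref_int c K B (avg_defect (B h) ((avg_defect (B h) ^^ N) F))"
    by (rule avg_defect_ref_int[OF K B continuous_on_avg_defect_pow[OF F(1)] norm_avg_defect_pow_le[OF F]])
  then show ?case using Suc by simp
qed simp

text \<open>\<open>f = ref_int c K B f\<close> is used once per factor \<open>avg_defect h\<close>; the step leaves
  \<open>avg_defect (B h)\<close> behind, whence the factor \<open>\<kappa> ^ N\<close> in the smallness condition on \<open>h\<close>.\<close>

lemma avg_defect_pow_decay:
  assumes K: "compact K" and B: "linear B" "\<And>x. norm (B x) \<le> \<kappa> * norm x" "\<kappa> \<ge> 1"
    and f: "continuous_on UNIV f" "\<And>x. norm (f x) \<le> M" "f = ref_int c K B f"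
    and q: "\<And>w. norm w \<le> \<delta> \<Longrightarrow>
      2 * cmod c * (LINT u|lborel. \<bar>indicator K (u - w) - indicator K u\<bar>) \<le> q"
  shows "norm h * \<kappa> ^ N \<le> \<delta> \<Longrightarrow> norm ((avg_defect h ^^ N) f x) \<le> q ^ N * M"
proof (induction N arbitrary: h x)
  case 0
  then show ?case using f by simp
next
  case (Suc N)
  define F where "F = (avg_defect (B h) ^^ N) f"
  have F: "continuous_on UNIV F"
    unfolding F_def by (intro continuous_on_avg_defect_pow f)
  \<comment> \<open>\<open>B h\<close> meets the smallness condition with one factor
    \<open>\<kappa>\<close> less, so the induction hypothesis applies to it.\<close>
  have "norm (B h) * \<kappa> ^ N \<le> \<kappa> * norm h * \<kappa> ^ N"
    using B by (intro mult_right_mono) auto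
  then have FM: "norm (F y) \<le> q ^ N * M" for y
    unfolding F_def using Suc.prems by (intro Suc.IH) (simp add: mult_ac)
  have qNM: "q ^ N * M \<ge> 0"
    using FM[of 0] norm_ge_zero order_trans by blast
  have "norm h * 1 \<le> norm h * \<kappa> ^ Suc N"
    using B(3) by (intro mult_left_mono one_le_power) auto
  then have h: "norm h \<le> \<delta>" using Suc.prems by linarith
  \<comment> \<open>Of the \<open>Suc N\<close> defects, \<open>N\<close> pass inside the operator
    and one stays outside; the outer one supplies the new factor \<open>q\<close>.\<close>
  have eq: "(avg_defect h ^^ Suc N) f = avg_defect h (ref_int c K B F)"
    unfolding F_def avg_defect_pow_ref_int[OF K B(1) f(1,2), symmetric] using f(3) by simp
  \<comment> \<open>The oscillation is estimated by \<open>q / 2\<close> times the bound of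
    \<open>F\<close>, since passing to the defect doubles it.\<close>
  have "norm (avg_defect h (ref_int c K B F) x) \<le> 2 * (q / 2 * (q ^ N * M))"
  proof (rule norm_avg_defect_le_oscillation)
    show "continuous_on UNIV (ref_int c K B F)"
      by (rule continuous_on_ref_int[OF K B(1) F FM])
    fix y and t :: real assume t: "t \<in> {0..1}"
    have "norm (t *\<^sub>R h) \<le> \<delta>"
      using t h mult_left_le_one_le[of "norm h" t] by auto
    then have *: "cmod c * (LINT u|lborel. \<bar>indicator K (u - t *\<^sub>R h) - indicator K u\<bar>) \<le> q / 2"
      using q by fastforce
    have "norm (ref_int c K B F (y - t *\<^sub>R h) - ref_int c K B F y)
        \<le> cmod c * (LINT u|lborel. \<bar>indicator K (u - t *\<^sub>R h) - indicator K u\<bar>) * (q ^ N * M)"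
      by (rule ref_int_translate_le[OF K B(1) F FM])
    also have "\<dots> \<le> q / 2 * (q ^ N * M)"
      by (rule mult_right_mono[OF * qNM])
    finally show "norm (ref_int c K B F y - ref_int c K B F (y - t *\<^sub>R h)) \<le> q / 2 * (q ^ N * M)"
      by (simp add: norm_minus_commute)
  qed
  then show ?case unfolding eq by (simp add: mult.assoc)
qed

section \<open>Differentiability of fixed points\<close>

text \<open>A Landau-type inequality: over a step \<open>\<sigma>\<close> the increment of
  \<open>\<phi>\<close> is at most \<open>2 * a\<close> and differs from
  \<open>\<sigma> *\<^sub>R \<phi>' 0\<close> by at most
  \<open>L * \<sigma>\<^sup>2\<close>.\<close>

lemma interpolation_bound:
  fixes \<phi> :: "real \<Rightarrow> complex"
  assumes der: "\<And>s. (\<phi> has_vector_derivative \<phi>' s) (at s)"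
    and bdd: "\<And>s. norm (\<phi> s) \<le> a"
    and Lip: "\<And>s. norm (\<phi>' s - \<phi>' 0) \<le> L * \<bar>s\<bar>"
    and "\<sigma> > 0"
  shows "norm (\<phi>' 0) \<le> 2 * a / \<sigma> + L * \<sigma>"
proof -
  have L: "L \<ge> 0" using order_trans[OF norm_ge_zero Lip[of 1]] by simp
  have "norm (\<phi> \<sigma> - \<phi> 0 - (\<sigma> - 0) *\<^sub>R \<phi>' 0) \<le> norm (\<sigma> - 0) * (L * \<sigma>)"
  proof (rule vector_differentiable_bound_linearization)
    show "(\<phi> has_vector_derivative \<phi>' s) (at s within {0..\<sigma>})" for s
      by (rule has_vector_derivative_at_within[OF der])
    show "norm (\<phi>' s - \<phi>' 0) \<le> L * \<sigma>" if "s \<in> {0..\<sigma>}" for s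
      using Lip[of s] that L mult_left_mono[of s \<sigma> L] by auto
  qed (use \<open>\<sigma> > 0\<close> in \<open>auto simp: closed_segment_eq_real_ivl\<close>)
  then have "norm (\<sigma> *\<^sub>R \<phi>' 0) \<le> \<sigma> * (L * \<sigma>) + 2 * a"
    using norm_triangle_ineq4[of "\<phi> \<sigma> - \<phi> 0" "\<phi> \<sigma> - \<phi> 0 - \<sigma> *\<^sub>R \<phi>' 0"]
      norm_triangle_ineq4[of "\<phi> \<sigma>" "\<phi> 0"] bdd[of \<sigma>] bdd[of 0] \<open>\<sigma> > 0\<close> by simp
  then show ?thesis using \<open>\<sigma> > 0\<close> by (simp add: field_simps)
qed

text \<open>The Weierstrass test, applied to the telescoping series, makes the \<open>g' n\<close>
  converge uniformly on the whole space. So the limit is continuous, and limit and derivative may be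
  exchanged along each line in direction \<open>e\<close>.\<close>

lemma directional_derivative_limit:
  fixes g g' :: "nat \<Rightarrow> 'a::real_normed_vector \<Rightarrow> complex"
  assumes der: "\<And>n x s. ((\<lambda>s. g n (x + s *\<^sub>R e)) has_vector_derivative g' n (x + s *\<^sub>R e)) (at s)"
    and cont: "\<And>n. continuous_on UNIV (g' n)"
    and lim: "\<And>x. (\<lambda>n. g n x) \<longlonglongrightarrow> f x"
    and M: "summable M" "\<And>n x. norm (g' (Suc n) x - g' n x) \<le> M n"
  shows "\<exists>f'. continuous_on UNIV f' \<and>
           (\<forall>x. ((\<lambda>s. f (x + s *\<^sub>R e)) has_vector_derivative f' x) (at 0))"
proof -
  define d where "d x = (\<Sum>n. g' (Suc n) x - g' n x)" for x
  define f' where "f' x = g' 0 x + d x" for x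
  have "uniform_limit UNIV (\<lambda>n x. \<Sum>i<n. g' (Suc i) x - g' i x) d sequentially"
    unfolding d_def by (rule Weierstrass_m_test[OF M(2,1)])
  then have "uniform_limit UNIV (\<lambda>n x. g' 0 x + (\<Sum>i<n. g' (Suc i) x - g' i x)) f' sequentially"
    unfolding f'_def by (intro uniform_limit_intros)
  then have ul: "uniform_limit UNIV g' f' sequentially"
    using sum_lessThan_telescope[of "\<lambda>i. g' i x" for x] by simp
  have "continuous_on UNIV f'"
    by (rule uniform_limit_theorem[OF _ ul]) (auto simp: cont)
  moreover have "((\<lambda>s. f (x + s *\<^sub>R e)) has_vector_derivative f' x) (at 0)" for x
  proof -
    have "\<exists>h. \<forall>s\<in>UNIV. (\<lambda>n. g n (x + s *\<^sub>R e)) \<longlonglongrightarrow> h s \<and>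
        (h has_derivative (\<lambda>t. t *\<^sub>R f' (x + s *\<^sub>R e))) (at s within UNIV)"
    proof (rule has_derivative_sequence[where ?x0.0 = 0 and l = "f x"])
      show "((\<lambda>s. g n (x + s *\<^sub>R e)) has_derivative (\<lambda>t. t *\<^sub>R g' n (x + s *\<^sub>R e))) (at s within UNIV)"
        for n s using der by (simp add: has_vector_derivative_def)
      fix \<epsilon> :: real assume "\<epsilon> > 0"
      from uniform_limitD[OF ul this]
      show "\<forall>\<^sub>F n in sequentially. \<forall>s\<in>UNIV. \<forall>t. norm (t *\<^sub>R g' n (x + s *\<^sub>R e) - t *\<^sub>R f' (x + s *\<^sub>R e))
          \<le> \<epsilon> * norm t"
      proof eventually_elim
        case (elim n)
        have "norm (t *\<^sub>R g' n y - t *\<^sub>R f' y) \<le> \<epsilon> * norm t" for t :: real and y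
        proof -
          have "norm (g' n y - f' y) \<le> \<epsilon>"
            using elim by (simp add: dist_norm less_imp_le)
          then have "\<bar>t\<bar> * norm (g' n y - f' y) \<le> \<bar>t\<bar> * \<epsilon>"
            by (intro mult_left_mono) auto
          then show ?thesis
            by (simp only: norm_scaleR scaleR_diff_right[symmetric] real_norm_def mult.commute[of \<epsilon>])
        qed
        then show ?case by blast
      qed
    next
      show "(\<lambda>n. g n (x + 0 *\<^sub>R e)) \<longlonglongrightarrow> f x" using lim by simp
    qed auto
    then obtain h where h: "\<And>s. (\<lambda>n. g n (x + s *\<^sub>R e)) \<longlonglongrightarrow> h s"
      "\<And>s. (h has_derivative (\<lambda>t. t *\<^sub>R f' (x + s *\<^sub>R e))) (at s)" by auto
    have "h = (\<lambda>s. f (x + s *\<^sub>R e))"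
      using LIMSEQ_unique[OF h(1) lim] by blast
    then show ?thesis
      using h(2)[of 0] by (simp add: has_vector_derivative_def)
  qed
  ultimately show ?thesis by blast
qed

text \<open>The approximations \<open>g N\<close> differ from \<open>f\<close> by
  \<open>O(q^N)\<close>, while their derivatives along \<open>e\<close> have Lipschitz constants
  \<open>O(\<Lambda>^N)\<close>. \<open>interpolation_bound\<close> combines the two into derivative
  increments of order \<open>2^-N\<close>, which are summable.\<close>

lemma ref_int_fixed_point_directional_derivative:
  fixes K :: "'a::euclidean_space set"
  assumes K: "compact K" and B: "linear B"
    and f: "continuous_on UNIV f" "\<And>x. norm (f x) \<le> M" "f = ref_int c K B f"
  shows "\<exists>f'. continuous_on UNIV f' \<and>
           (\<forall>x. ((\<lambda>s. f (x + s *\<^sub>R e)) has_vector_derivative f' x) (at 0))"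
proof -
  have M: "M \<ge> 0" using f(2)[of 0] norm_ge_zero order_trans by blast
  obtain \<kappa>0 where \<kappa>0: "\<And>x. norm (B x) \<le> norm x * \<kappa>0"
    using bounded_linear.bounded B linear_conv_bounded_linear by blast
  define \<kappa> where "\<kappa> = max 1 \<kappa>0"
  have \<kappa>: "\<kappa> \<ge> 1" "norm (B x) \<le> \<kappa> * norm x" for x
    using \<kappa>0[of x] mult_left_mono[of \<kappa>0 \<kappa> "norm x"] by (auto simp: \<kappa>_def mult.commute)
  define \<Lambda> where "\<Lambda> = 2 * \<kappa>\<^sup>2"
  have \<Lambda>: "\<Lambda> \<ge> 2" using one_le_power[OF \<kappa>(1), of 2] by (simp add: \<Lambda>_def)
  \<comment> \<open>\<open>\<Lambda> ^ N\<close> is the growth rate of the Lipschitz constants of the derivatives of the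
    approximations \<open>g N\<close> below; \<open>q\<close> makes \<open>q ^ N\<close> beat it in \<open>interpolation_bound\<close>.\<close>
  define q where "q = 1 / (4 * \<Lambda>)"
  have q: "0 < q" "q \<le> 1" "2 * \<Lambda> * q = 1 / 2" using \<Lambda> by (auto simp: q_def)
  obtain \<delta> where "\<delta> > 0" and \<delta>: "\<And>w. norm w \<le> \<delta> \<Longrightarrow>
      2 * cmod c * (LINT u|lborel. \<bar>indicator K (u - w) - indicator K u\<bar>) \<le> q"
  proof -
    \<comment> \<open>The summand 1 covers \<open>c = 0\<close>, as the one in \<open>\<rho>\<close>
      below covers \<open>e = 0\<close>.\<close>
    have "q / (2 * cmod c + 1) > 0" using q by (intro divide_pos_pos add_nonneg_pos) auto
    from L1_continuity_of_translation[OF K this] obtain \<delta> where "\<delta> > 0" and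
      \<delta>: "\<And>w. norm w \<le> \<delta> \<Longrightarrow>
        (LINT u|lborel. \<bar>indicator K (u - w) - indicator K u\<bar>) \<le> q / (2 * cmod c + 1)" by blast
    have "2 * cmod c * (q / (2 * cmod c + 1)) \<le> (2 * cmod c + 1) * (q / (2 * cmod c + 1))"
      using q by (intro mult_right_mono) auto
    also have "\<dots> = q"
      using norm_ge_zero[of c] by (simp add: add_nonneg_eq_0_iff)
    finally have *: "2 * cmod c * (q / (2 * cmod c + 1)) \<le> q" .
    show thesis
      by (rule that[OF \<open>\<delta> > 0\<close>], rule order_trans[OF mult_left_mono *]) (simp_all add: \<delta>)
  qed
  define \<rho> where "\<rho> = \<delta> / (norm e + 1)"
  have \<rho>: "\<rho> > 0" "\<rho> * norm e \<le> \<delta>"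
  proof -
    have X: "norm e + 1 > 0" "norm e \<le> norm e + 1" by (auto intro: add_nonneg_pos)
    then show "\<rho> > 0" using \<open>\<delta> > 0\<close> by (simp add: \<rho>_def)
    have "\<delta> * norm e \<le> \<delta> * (norm e + 1)" using \<open>\<delta> > 0\<close> X by (intro mult_left_mono) auto
    then show "\<rho> * norm e \<le> \<delta>" using X by (simp only: \<rho>_def times_divide_eq_left pos_divide_le_eq)
  qed
  \<comment> \<open>The step length shrinks like \<open>\<kappa>^-N\<close> so that
    \<open>avg_defect_pow_decay\<close> covers \<open>N\<close> defects along
    \<open>h N\<close>.\<close>
  define r where "r N = \<rho> / \<kappa> ^ N" for N
  have r: "r N > 0" for N using \<rho> \<kappa> by (simp add: r_def)
  have r_eq: "\<rho> = r N * \<kappa> ^ N" for N using \<kappa> by (simp add: r_def)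
  define h where "h N = r N *\<^sub>R e" for N
  have h_small: "norm (h N) * \<kappa> ^ N \<le> \<delta>" for N
    using \<rho>(2) r[of N] unfolding r_eq[of N] by (simp add: h_def mult_ac)
  define F where "F N i = (avg_defect (h N) ^^ i) f" for N i
  define W where "W N i = avg (h N) (F N i)" for N i
  define g where "g N x = f x - F N N x" for N x
  define g' where "g' N x = (\<Sum>i<N. (1 / r N) *\<^sub>R (W N i x - W N i (x - h N)))" for N x
  have F_cont: "continuous_on UNIV (F N i)" for N i
    unfolding F_def by (intro continuous_on_avg_defect_pow f)
  have F_bdd: "norm (F N i x) \<le> 2 ^ i * M" for N i x
    unfolding F_def by (intro norm_avg_defect_pow_le f)
  have W_cont: "continuous_on UNIV (W N i)" for N i
    unfolding W_def by (intro continuous_on_avg F_cont)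
  have tiny: "norm (F N N x) \<le> q ^ N * M" for N x
    unfolding F_def by (rule avg_defect_pow_decay[OF K B \<kappa>(2,1) f \<delta> h_small])
  \<comment> \<open>The geometric sum for \<open>1 - T^N\<close>, where \<open>T\<close> is the
    defect and \<open>1 - T\<close> the double average. One average is already in
    \<open>W N i\<close>; the other makes each term differentiable along \<open>e\<close>.\<close>
  have g_eq: "g N x = (\<Sum>i<N. avg (h N) (W N i) x)" for N x
  proof -
    have "avg (h N) (W N i) x = F N i x - F N (Suc i) x" for i
      by (simp add: F_def W_def avg_defect_def)
    then show ?thesis
      using sum_lessThan_telescope'[of "\<lambda>i. F N i x" N] by (simp add: g_def F_def)
  qed
  have der: "((\<lambda>s. g N (x + s *\<^sub>R e)) has_vector_derivative g' N (x + s *\<^sub>R e)) (at s)" for N x s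
  proof -
    have "((\<lambda>s. avg (h N) (W N i) (x + s *\<^sub>R e)) has_vector_derivative
        (1 / r N) *\<^sub>R (W N i (x + s *\<^sub>R e) - W N i (x + s *\<^sub>R e - h N))) (at s)" for i
    proof -
      have eq: "(s / r N) *\<^sub>R h N = s *\<^sub>R e" for s
        using r[of N] by (simp add: h_def)
      have "((\<lambda>s. avg (h N) (W N i) (x + s *\<^sub>R h N)) \<circ> (\<lambda>s. s / r N) has_vector_derivative
        (1 / r N) *\<^sub>R (W N i (x + (s / r N) *\<^sub>R h N) - W N i (x + (s / r N) *\<^sub>R h N - h N))) (at s)"
        by (rule vector_diff_chain_at[OF _ avg_has_vector_derivative[OF W_cont]])
          (use r[of N] in \<open>auto intro!: derivative_eq_intros\<close>)
      then show ?thesis by (simp only: eq o_def)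
    qed
    then show ?thesis
      unfolding g_eq g'_def by (intro has_vector_derivative_sum)
  qed
  have g'_cont: "continuous_on UNIV (g' N)" for N
    unfolding g'_def[abs_def]
    by (intro continuous_intros W_cont continuous_on_compose_UNIV[OF W_cont])
  have g'_Lip: "norm (g' N (x + s *\<^sub>R e) - g' N x) \<le> 4 * M * \<Lambda> ^ N / \<rho>\<^sup>2 * \<bar>s\<bar>" for N x s
  proof -
    \<comment> \<open>A move by \<open>s\<close> along \<open>e\<close> is one by
      \<open>s / r N\<close> along \<open>h N\<close>; \<open>2 ^ i * M\<close> bounds the iterated
      defect under the average.\<close>
    have W_Lip: "norm (W N i (y + s *\<^sub>R e) - W N i y) \<le> 2 * (2 ^ i * M) * \<bar>s / r N\<bar>" for i y
      using avg_Lipschitz_along[OF F_cont[of N i] F_bdd[of N i], of "h N" y "s / r N"] r[of N]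
      by (simp add: W_def h_def)
    have summand: "norm ((1 / r N) *\<^sub>R (W N i (x + s *\<^sub>R e) - W N i (x + s *\<^sub>R e - h N))
        - (1 / r N) *\<^sub>R (W N i x - W N i (x - h N))) \<le> 2 ^ i * (4 * M / (r N)\<^sup>2 * \<bar>s\<bar>)" for i
    proof -
      let ?a = "W N i (x + s *\<^sub>R e) - W N i x"
      let ?b = "W N i (x - h N + s *\<^sub>R e) - W N i (x - h N)"
      have "norm (?a - ?b) \<le> 2 * (2 ^ i * M) * \<bar>s / r N\<bar> + 2 * (2 ^ i * M) * \<bar>s / r N\<bar>"
        by (rule norm_triangle_le_diff[OF add_mono[OF W_Lip[of i x] W_Lip[of i "x - h N"]]])
      then have "norm (?a - ?b) \<le> 4 * (2 ^ i * M) * \<bar>s / r N\<bar>"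
        by (simp add: mult_ac)
      then have "(1 / r N) * norm (?a - ?b) \<le> (1 / r N) * (4 * (2 ^ i * M) * \<bar>s / r N\<bar>)"
        using r[of N] by (intro mult_left_mono) auto
      moreover have "norm ((1 / r N) *\<^sub>R (W N i (x + s *\<^sub>R e) - W N i (x + s *\<^sub>R e - h N))
          - (1 / r N) *\<^sub>R (W N i x - W N i (x - h N))) = norm ((1 / r N) *\<^sub>R (?a - ?b))"
        by (simp add: algebra_simps)
      moreover have "norm ((1 / r N) *\<^sub>R (?a - ?b)) = (1 / r N) * norm (?a - ?b)"
        using r[of N] by simp
      ultimately have "norm ((1 / r N) *\<^sub>R (W N i (x + s *\<^sub>R e) - W N i (x + s *\<^sub>R e - h N))
        - (1 / r N) *\<^sub>R (W N i x - W N i (x - h N))) \<le> (1 / r N) * (4 * (2 ^ i * M) * \<bar>s / r N\<bar>)"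
        by metis
      also have "\<dots> = 2 ^ i * (4 * M / (r N)\<^sup>2 * \<bar>s\<bar>)"
        using r[of N] by (simp add: power2_eq_square)
      finally show ?thesis .
    qed
    have sum_pow2: "(\<Sum>i<N. 2 ^ i) \<le> (2 ^ N :: real)"
      by (induction N) auto
    have "norm (g' N (x + s *\<^sub>R e) - g' N x) \<le> (\<Sum>i<N. 2 ^ i * (4 * M / (r N)\<^sup>2 * \<bar>s\<bar>))"
      unfolding g'_def sum_subtractf[symmetric] by (intro sum_norm_le summand)
    also have "\<dots> = (\<Sum>i<N. 2 ^ i) * (4 * M / (r N)\<^sup>2 * \<bar>s\<bar>)"
      by (rule sum_distrib_right[symmetric])
    also have "\<dots> \<le> 2 ^ N * (4 * M / (r N)\<^sup>2 * \<bar>s\<bar>)"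
      using M by (intro mult_right_mono) (auto simp: sum_pow2)
    \<comment> \<open>Two factors \<open>1 / r N\<close>, one from the derivative and one from its
      Lipschitz estimate, contribute \<open>(\<kappa>\<^sup>2) ^ N\<close>; together with
      \<open>2 ^ N\<close> this is \<open>\<Lambda> ^ N\<close>.\<close>
    also have "(r N)\<^sup>2 = \<rho>\<^sup>2 / (\<kappa>\<^sup>2) ^ N"
      by (simp only: r_def power_divide power_mult[symmetric] mult.commute)
    also have "2 ^ N * (4 * M / (\<rho>\<^sup>2 / (\<kappa>\<^sup>2) ^ N) * \<bar>s\<bar>) = 4 * M * \<Lambda> ^ N / \<rho>\<^sup>2 * \<bar>s\<bar>"
      by (simp add: \<Lambda>_def power_mult_distrib)
    finally show ?thesis .
  qed
  define C where "C = 4 * M + 4 * M / \<rho>\<^sup>2 * (\<Lambda> + 1)"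
  show ?thesis
  proof (rule directional_derivative_limit[OF der g'_cont])
    fix x
    have "(\<lambda>N. F N N x) \<longlonglongrightarrow> 0"
    proof (rule Lim_null_comparison)
      show "\<forall>\<^sub>F N in sequentially. norm (F N N x) \<le> q ^ N * M" using tiny by simp
      have "q < 1" using q \<Lambda> by (simp add: q_def)
      then show "(\<lambda>N. q ^ N * M) \<longlonglongrightarrow> 0"
        using q by (intro tendsto_mult_left_zero LIMSEQ_realpow_zero) auto
    qed
    from tendsto_diff[OF tendsto_const[of "f x"] this]
    show "(\<lambda>N. g N x) \<longlonglongrightarrow> f x" unfolding g_def by simp
  next
    show "summable (\<lambda>N. C * (1 / 2) ^ N)"
      by (intro summable_mult summable_geometric) auto
  next
    fix N x
    \<comment> \<open>The Lipschitz constants at levels \<open>N + 1\<close> and \<open>N\<close>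
      add up to the factor \<open>\<Lambda> + 1\<close>.\<close>
    define L where "L = 4 * M / \<rho>\<^sup>2 * (\<Lambda> + 1) * \<Lambda> ^ N"
    define \<phi> where "\<phi> s = g (Suc N) (x + s *\<^sub>R e) - g N (x + s *\<^sub>R e)" for s
    define \<phi>' where "\<phi>' s = g' (Suc N) (x + s *\<^sub>R e) - g' N (x + s *\<^sub>R e)" for s
    \<comment> \<open>The step \<open>1 / (2 * \<Lambda>) ^ N\<close> brings the Lipschitz part down
      to order \<open>2^-N\<close>; the other part becomes a multiple of
      \<open>(2 * \<Lambda> * q) ^ N\<close>, which is also \<open>2^-N\<close>.\<close>
    have "norm (\<phi>' 0) \<le> 2 * (2 * (q ^ N * M)) / (1 / (2 * \<Lambda>) ^ N) + L * (1 / (2 * \<Lambda>) ^ N)"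
    proof (rule interpolation_bound)
      show "(\<phi> has_vector_derivative \<phi>' s) (at s)" for s
        unfolding \<phi>_def \<phi>'_def by (intro has_vector_derivative_diff der)
      show "norm (\<phi> s) \<le> 2 * (q ^ N * M)" for s
      proof -
        have "q * (q ^ N * M) \<le> q ^ N * M"
          using q M by (intro mult_left_le_one_le) auto
        then show ?thesis
          using norm_triangle_ineq4[of "F N N (x + s *\<^sub>R e)" "F (Suc N) (Suc N) (x + s *\<^sub>R e)"]
            tiny[of N "x + s *\<^sub>R e"] tiny[of "Suc N" "x + s *\<^sub>R e"]
          by (simp add: \<phi>_def g_def)
      qed
      show "norm (\<phi>' s - \<phi>' 0) \<le> L * \<bar>s\<bar>" for s
      proof -
        let ?a = "g' (Suc N) (x + s *\<^sub>R e) - g' (Suc N) x"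
        let ?b = "g' N (x + s *\<^sub>R e) - g' N x"
        have "norm (?a - ?b) \<le> 4 * M * \<Lambda> ^ Suc N / \<rho>\<^sup>2 * \<bar>s\<bar> + 4 * M * \<Lambda> ^ N / \<rho>\<^sup>2 * \<bar>s\<bar>"
          using norm_triangle_ineq4[of ?a ?b] g'_Lip[of "Suc N" x s] g'_Lip[of N x s] by linarith
        also have "\<dots> = L * \<bar>s\<bar>" by (simp add: L_def algebra_simps add_divide_distrib)
        finally show ?thesis by (simp add: \<phi>'_def algebra_simps)
      qed
      show "1 / (2 * \<Lambda>) ^ N > 0" using \<Lambda> by simp
    qed
    also have "2 * (2 * (q ^ N * M)) / (1 / (2 * \<Lambda>) ^ N) = 4 * M * (2 * \<Lambda> * q) ^ N"
      by (simp add: power_mult_distrib)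
    also have "L * (1 / (2 * \<Lambda>) ^ N) = 4 * M / \<rho>\<^sup>2 * (\<Lambda> + 1) * (1 / 2) ^ N"
      using \<Lambda> by (simp add: L_def power_mult_distrib power_divide)
    also have "4 * M * (2 * \<Lambda> * q) ^ N + 4 * M / \<rho>\<^sup>2 * (\<Lambda> + 1) * (1 / 2) ^ N = C * (1 / 2) ^ N"
      unfolding q(3) C_def by (rule distrib_right[symmetric])
    finally show "norm (g' (Suc N) x - g' N x) \<le> C * (1 / 2) ^ N"
      by (simp add: \<phi>'_def)
  qed
qed

section \<open>Continuously differentiable functions\<close>

text \<open>The increment is built up one coordinate at a time. Each move is compared with its
  linear part by the mean value inequality, and continuity of the partial derivatives makes the
  error small.\<close>

lemma has_derivative_of_continuous_partials:
  fixes f :: "real^'n \<Rightarrow> complex"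
  assumes der: "\<And>i x. ((\<lambda>s. f (x + s *\<^sub>R axis i 1)) has_vector_derivative f' i x) (at 0)"
    and cont: "\<And>i. continuous_on UNIV (f' i)"
  shows "(f has_derivative (\<lambda>h. \<Sum>i\<in>UNIV. h $ i *\<^sub>R f' i x)) (at x)"
  unfolding has_derivative_at_alt
proof (intro conjI allI impI)
  show "bounded_linear (\<lambda>h. \<Sum>i\<in>UNIV. h $ i *\<^sub>R f' i x)"
    by (intro bounded_linear_sum bounded_linear_scaleR_const bounded_linear_vec_nth)
  fix \<epsilon> :: real assume "\<epsilon> > 0"
  define \<eta> where "\<eta> = \<epsilon> / CARD('n)"
  have "\<eta> > 0" using \<open>\<epsilon> > 0\<close> by (simp add: \<eta>_def)
  have "\<forall>i. \<exists>d>0. \<forall>y. norm (y - x) < d \<longrightarrow> norm (f' i y - f' i x) \<le> \<eta>"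
  proof
    fix i
    show "\<exists>d>0. \<forall>y. norm (y - x) < d \<longrightarrow> norm (f' i y - f' i x) \<le> \<eta>"
      using cont[of i] \<open>\<eta> > 0\<close> unfolding continuous_on_iff dist_norm by (meson UNIV_I less_imp_le)
  qed
  then obtain d where d: "\<And>i. d i > 0"
    "\<And>i y. norm (y - x) < d i \<Longrightarrow> norm (f' i y - f' i x) \<le> \<eta>" by metis
  define \<delta> where "\<delta> = Min (range d)"
  have "\<delta> > 0" using d(1) by (simp add: \<delta>_def)
  have \<delta>: "norm (f' i y - f' i x) \<le> \<eta>" if "norm (y - x) < \<delta>" for i y
    using that by (intro d(2)) (simp add: \<delta>_def)
  have "norm (f y - f x - (\<Sum>i\<in>UNIV. (y - x) $ i *\<^sub>R f' i x)) \<le> \<epsilon> * norm (y - x)"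
    if y: "norm (y - x) < \<delta>" for y
  proof -
    define h where "h = y - x"
    define p where "p S = (\<chi> i. if i \<in> S then h $ i else 0)" for S
    have step: "norm (f (x + p S) - f x - (\<Sum>i\<in>S. h $ i *\<^sub>R f' i x)) \<le> \<eta> * (\<Sum>i\<in>S. \<bar>h $ i\<bar>)"
      if "finite S" for S using that
    proof (induction S rule: finite_induct)
      case empty
      have "p {} = 0" by (simp add: p_def vec_eq_iff)
      then show ?case by simp
    next
      case (insert j S)
      \<comment> \<open>With the linear part subtracted, the derivative of \<open>\<psi>\<close> is
        a difference of two values of \<open>f' j\<close>, at most \<open>\<eta>\<close> near
        \<open>x\<close>.\<close>
      define \<psi> where "\<psi> t = f (x + p S + t *\<^sub>R axis j 1) - t *\<^sub>R f' j x" for t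
      have pj: "p (insert j S) = p S + h $ j *\<^sub>R axis j 1"
        using insert.hyps by (auto simp: p_def vec_eq_iff axis_def)
      \<comment> \<open>No coordinate of an intermediate point exceeds that of \<open>h\<close> in
        absolute value, so the path stays in the ball.\<close>
      have near: "norm (p S + t *\<^sub>R axis j 1) < \<delta>" if "t \<in> closed_segment 0 (h $ j)" for t
      proof -
        have "\<bar>t\<bar> \<le> \<bar>h $ j\<bar>"
          using that by (auto simp: closed_segment_eq_real_ivl split: if_splits)
        then have "norm (p S + t *\<^sub>R axis j 1) \<le> norm h"
          using insert.hyps by (intro norm_le_componentwise_cart) (auto simp: p_def axis_def)
        then show ?thesis using y by (simp add: h_def)
      qed
      have "norm (\<psi> (h $ j) - \<psi> 0) \<le> \<eta> * norm (h $ j - 0)"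
      proof (rule differentiable_bound[of "closed_segment 0 (h $ j)"])
        fix t assume t: "t \<in> closed_segment 0 (h $ j)"
        \<comment> \<open>The hypothesis gives derivatives at parameter 0 only, so the base point is
          moved to reach \<open>t\<close>.\<close>
        have "((\<lambda>s. f (x + p S + t *\<^sub>R axis j 1 + s *\<^sub>R axis j 1)) \<circ> (\<lambda>s. s - t) has_vector_derivative
            1 *\<^sub>R f' j (x + p S + t *\<^sub>R axis j 1)) (at t)"
          by (rule vector_diff_chain_at) (auto intro!: derivative_eq_intros der)
        then have "((\<lambda>s. f (x + p S + s *\<^sub>R axis j 1)) has_vector_derivative
            f' j (x + p S + t *\<^sub>R axis j 1)) (at t)"
          by (simp add: o_def add.assoc flip: scaleR_add_left)
        then have "(\<psi> has_vector_derivative f' j (x + p S + t *\<^sub>R axis j 1) - f' j x) (at t)"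
          unfolding \<psi>_def by (auto intro!: derivative_eq_intros)
        then show "(\<psi> has_derivative (\<lambda>s. s *\<^sub>R (f' j (x + p S + t *\<^sub>R axis j 1) - f' j x)))
            (at t within closed_segment 0 (h $ j))"
          unfolding has_vector_derivative_def by (rule has_derivative_at_withinI)
        have "norm (f' j (x + p S + t *\<^sub>R axis j 1) - f' j x) \<le> \<eta>"
          using near[OF t] by (intro \<delta>) (simp add: algebra_simps)
        then show "onorm (\<lambda>s. s *\<^sub>R (f' j (x + p S + t *\<^sub>R axis j 1) - f' j x)) \<le> \<eta>"
          by (intro onorm_le) (simp add: mult_left_mono mult.commute[of \<eta>])
      qed auto
      then have "norm (f (x + p (insert j S)) - f (x + p S) - h $ j *\<^sub>R f' j x) \<le> \<eta> * \<bar>h $ j\<bar>"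
        by (simp add: \<psi>_def pj add.assoc diff_diff_eq add.commute)
      from norm_triangle_le[OF add_mono[OF this insert.IH]] insert.hyps
      show ?case by (simp add: algebra_simps)
    qed
    have "norm (f y - f x - (\<Sum>i\<in>UNIV. h $ i *\<^sub>R f' i x)) \<le> \<eta> * (\<Sum>i\<in>UNIV. \<bar>h $ i\<bar>)"
    proof -
      have "p UNIV = h" by (simp add: p_def vec_eq_iff)
      then show ?thesis using step[of UNIV] by (simp add: h_def)
    qed
    also have "\<dots> \<le> \<eta> * (\<Sum>i\<in>(UNIV::'n set). norm h)"
      using \<open>\<eta> > 0\<close> by (intro mult_left_mono sum_mono component_le_norm_cart) auto
    also have "\<dots> = \<epsilon> * norm h" by (simp add: \<eta>_def)
    finally show ?thesis by (simp add: h_def)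
  qed
  then show "\<exists>d>0. \<forall>y. norm (y - x) < d \<longrightarrow>
      norm (f y - f x - (\<Sum>i\<in>UNIV. (y - x) $ i *\<^sub>R f' i x)) \<le> \<epsilon> * norm (y - x)"
    using \<open>\<delta> > 0\<close> by blast
qed

text \<open>The real counterpart of \<open>cdir_deriv\<close>, serving as the candidate for the
  differential of \<open>g\<close>.\<close>

definition dir_deriv :: "real^'n \<Rightarrow> (real^'n \<Rightarrow> complex) \<Rightarrow> real^'n \<Rightarrow> complex" where
  "dir_deriv w g x = (\<Sum>i\<in>UNIV. w $ i *\<^sub>R partial_deriv i g x)"

definition C1 :: "(real^'n \<Rightarrow> complex) \<Rightarrow> bool" where
  "C1 g \<longleftrightarrow> (\<forall>x. (g has_derivative (\<lambda>h. dir_deriv h g x)) (at x)) \<and>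
            (\<forall>i. continuous_on UNIV (partial_deriv i g))"

lemma has_derivative_line:
  assumes "(g has_derivative g') (at (x + s *\<^sub>R w))"
  shows "((\<lambda>s. g (x + s *\<^sub>R w)) has_vector_derivative g' w) (at s)"
proof -
  have "((\<lambda>s. x + s *\<^sub>R w) has_vector_derivative w) (at s)"
    by (auto intro!: derivative_eq_intros)
  from vector_derivative_diff_chain_within[OF this, of g g'] assms
  show ?thesis by (simp add: o_def has_derivative_at_withinI)
qed

lemma partial_deriv_eq:
  assumes "(g has_derivative g') (at x)"
  shows "partial_deriv i g x = g' (axis i 1)"
  unfolding partial_deriv_def
  by (rule vector_derivative_at, rule has_derivative_line) (use assms in simp)

lemma dir_deriv_axis [simp]: "dir_deriv (axis i 1) g x = partial_deriv i g x"
proof -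
  have "dir_deriv (axis i 1) g x = (\<Sum>k\<in>UNIV. if k = i then partial_deriv i g x else 0)"
    unfolding dir_deriv_def axis_def by (intro sum.cong) auto
  then show ?thesis by simp
qed

lemma C1_has_derivative: "C1 g \<Longrightarrow> (g has_derivative (\<lambda>h. dir_deriv h g x)) (at x)"
  by (simp add: C1_def)

lemma C1_continuous_dir_deriv: "C1 g \<Longrightarrow> continuous_on UNIV (dir_deriv w g)"
  unfolding C1_def dir_deriv_def[abs_def] by (intro continuous_intros) auto

lemma C1_I:
  fixes f :: "real^'n \<Rightarrow> complex"
  assumes "\<And>i. \<exists>f'. continuous_on UNIV f' \<and>
      (\<forall>x. ((\<lambda>s. f (x + s *\<^sub>R axis i 1)) has_vector_derivative f' x) (at 0))"
  shows "C1 f"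
proof -
  obtain f' where f': "\<And>i. continuous_on UNIV (f' i)"
    "\<And>i x. ((\<lambda>s. f (x + s *\<^sub>R axis i 1)) has_vector_derivative f' i x) (at 0)"
    using assms by metis
  then have "partial_deriv i f = f' i" for i
    unfolding partial_deriv_def[abs_def] by (intro ext vector_derivative_at)
  then show ?thesis
    using f' has_derivative_of_continuous_partials[of f f'] by (simp add: C1_def dir_deriv_def)
qed

lemma C1_add:
  assumes "C1 g" "C1 h"
  shows "C1 (\<lambda>x. g x + h x)" "partial_deriv i (\<lambda>x. g x + h x) = (\<lambda>x. partial_deriv i g x + partial_deriv i h x)"
proof -
  have der: "((\<lambda>x. g x + h x) has_derivative (\<lambda>v. dir_deriv v g x + dir_deriv v h x)) (at x)" for x
    by (intro has_derivative_add C1_has_derivative assms)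
  have pd: "partial_deriv i (\<lambda>x. g x + h x) = (\<lambda>x. partial_deriv i g x + partial_deriv i h x)" for i
    using partial_deriv_eq[OF der] by (simp add: fun_eq_iff)
  then show "partial_deriv i (\<lambda>x. g x + h x) = (\<lambda>x. partial_deriv i g x + partial_deriv i h x)" .
  have "dir_deriv v (\<lambda>x. g x + h x) x = dir_deriv v g x + dir_deriv v h x" for v x
    by (simp add: dir_deriv_def pd scaleR_add_right sum.distrib)
  then show "C1 (\<lambda>x. g x + h x)"
    using der assms by (simp add: C1_def pd continuous_on_add)
qed

lemma C1_cmult:
  assumes "C1 g"
  shows "C1 (\<lambda>x. a * g x)" "partial_deriv i (\<lambda>x. a * g x) = (\<lambda>x. a * partial_deriv i g x)"
proof -
  have der: "((\<lambda>x. a * g x) has_derivative (\<lambda>v. a * dir_deriv v g x)) (at x)" for x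
    by (intro has_derivative_mult_right C1_has_derivative assms)
  have pd: "partial_deriv i (\<lambda>x. a * g x) = (\<lambda>x. a * partial_deriv i g x)" for i
    using partial_deriv_eq[OF der] by (simp add: fun_eq_iff)
  then show "partial_deriv i (\<lambda>x. a * g x) = (\<lambda>x. a * partial_deriv i g x)" .
  have "dir_deriv v (\<lambda>x. a * g x) x = a * dir_deriv v g x" for v x
    by (simp add: dir_deriv_def pd sum_distrib_left)
  then show "C1 (\<lambda>x. a * g x)"
    using der assms by (simp add: C1_def pd continuous_on_mult_left)
qed

section \<open>Functions supported in the window\<close>

lemma C_supp_zero_outside: "g \<in> C_supp \<Omega> \<Longrightarrow> x \<notin> \<Omega> \<Longrightarrow> g x = 0"
  unfolding C_supp_def using closure_subset[of "{x. g x \<noteq> 0}"] by auto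

lemma C_supp_bounded:
  assumes "g \<in> C_supp \<Omega>" "compact \<Omega>"
  shows "\<exists>M\<ge>0. \<forall>x. norm (g x) \<le> M"
proof -
  have "compact (g ` \<Omega>)"
    using assms by (intro compact_continuous_image) (auto simp: C_supp_def intro: continuous_on_subset)
  then obtain M where "\<And>y. y \<in> g ` \<Omega> \<Longrightarrow> norm y \<le> M"
    using compact_imp_bounded bounded_iff by metis
  then have "norm (g x) \<le> max M 0" for x
    using C_supp_zero_outside[OF assms(1), of x] by (cases "x \<in> \<Omega>") (auto simp: le_max_iff_disj)
  then show ?thesis by (intro exI[of _ "max M 0"]) auto
qed

lemma partial_deriv_zero_outside_support:
  assumes "x \<notin> closure {y. g y \<noteq> 0}"
  shows "partial_deriv i g x = 0"
proof -
  have "((\<lambda>_. 0) has_derivative (\<lambda>_. 0)) (at x)" by simp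
  then have "(g has_derivative (\<lambda>_. 0)) (at x)"
    by (rule has_derivative_transform_within_open[where s = "- closure {y. g y \<noteq> 0}"])
      (use assms closure_subset[of "{y. g y \<noteq> 0}"] in auto)
  then show ?thesis by (rule partial_deriv_eq)
qed

lemma cdir_deriv_in_C_supp:
  assumes "C1 g" "g \<in> C_supp \<Omega>"
  shows "cdir_deriv w g \<in> C_supp \<Omega>"
proof -
  have "continuous_on UNIV (cdir_deriv w g)"
    using assms(1) unfolding C1_def cdir_deriv_def[abs_def] by (intro continuous_intros) auto
  moreover have "cdir_deriv w g x = 0" if "x \<notin> closure {x. g x \<noteq> 0}" for x
    using partial_deriv_zero_outside_support[OF that] by (simp add: cdir_deriv_def)
  then have "{x. cdir_deriv w g x \<noteq> 0} \<subseteq> closure {x. g x \<noteq> 0}" by blast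
  then have "closure {x. cdir_deriv w g x \<noteq> 0} \<subseteq> closure {x. g x \<noteq> 0}"
    by (rule closure_minimal) simp
  ultimately show ?thesis using assms(2) by (auto simp: C_supp_def)
qed

text \<open>Along the real plane spanned by the real and imaginary parts of \<open>w\<close>, the equation
  \<open>cdir_deriv w g = 0\<close> is the Cauchy--Riemann equation.\<close>

lemma cdir_deriv_nonzero:
  fixes g :: "real^'n \<Rightarrow> complex"
  assumes "C1 g" "g \<in> C_supp \<Omega>" "compact \<Omega>" "w \<noteq> 0" "cdir_deriv w g = (\<lambda>x. 0)"
  shows "g = (\<lambda>x. 0)"
proof
  fix x
  define a where "a = (\<chi> i. Re (w $ i))"
  define b where "b = (\<chi> i. Im (w $ i))"
  define l where "l \<zeta> = Re \<zeta> *\<^sub>R a + Im \<zeta> *\<^sub>R b" for \<zeta>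
  define F where "F \<zeta> = g (x + l \<zeta>)" for \<zeta>
  have CR: "dir_deriv b g y = \<i> * dir_deriv a g y" for y
  proof -
    have "dir_deriv a g y + \<i> * dir_deriv b g y = cdir_deriv w g y"
      unfolding dir_deriv_def cdir_deriv_def a_def b_def sum_distrib_left sum.distrib[symmetric]
    proof (intro sum.cong refl)
      fix i
      have "(complex_of_real (Re (w $ i)) + \<i> * complex_of_real (Im (w $ i))) * partial_deriv i g y
          = w $ i * partial_deriv i g y"
        by (simp only: complex_eq[symmetric])
      then show "(\<chi> i. Re (w $ i)) $ i *\<^sub>R partial_deriv i g y +
          \<i> * ((\<chi> i. Im (w $ i)) $ i *\<^sub>R partial_deriv i g y) = w $ i * partial_deriv i g y"
        by (simp add: scaleR_conv_of_real algebra_simps)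
    qed
    then have "dir_deriv a g y + \<i> * dir_deriv b g y = 0" using assms(5) by simp
    then have "\<i> * (dir_deriv a g y + \<i> * dir_deriv b g y) = 0" by simp
    then show ?thesis by (simp add: distrib_left flip: mult.assoc)
  qed
  have dir_l: "dir_deriv (l \<zeta>) g y = dir_deriv a g y * \<zeta>" for \<zeta> y
  proof -
    have "dir_deriv (l \<zeta>) g y = Re \<zeta> *\<^sub>R dir_deriv a g y + Im \<zeta> *\<^sub>R dir_deriv b g y"
      by (simp add: l_def dir_deriv_def scaleR_add_left sum.distrib scaleR_sum_right)
    also have "\<dots> = dir_deriv a g y * (complex_of_real (Re \<zeta>) + \<i> * complex_of_real (Im \<zeta>))"
      unfolding CR by (simp add: scaleR_conv_of_real algebra_simps)
    finally show ?thesis by (simp only: complex_eq[symmetric])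
  qed
  \<comment> \<open>By \<open>CR\<close> the real differential of \<open>F\<close> is multiplication
    by a complex number.\<close>
  have "(F has_field_derivative dir_deriv a g (x + l \<zeta>)) (at \<zeta>)" for \<zeta>
  proof -
    have l: "((\<lambda>\<zeta>. x + l \<zeta>) has_derivative l) (at \<zeta>)"
      unfolding l_def by (auto intro!: derivative_eq_intros)
    have "(g \<circ> (\<lambda>\<zeta>. x + l \<zeta>) has_derivative (\<lambda>h. dir_deriv h g (x + l \<zeta>)) \<circ> l) (at \<zeta>)"
      by (rule diff_chain_at[OF l C1_has_derivative[OF assms(1)]])
    then show ?thesis
      unfolding has_field_derivative_def by (simp add: o_def dir_l F_def[abs_def])
  qed
  then have "F holomorphic_on UNIV"
    by (metis field_differentiable_at_within field_differentiable_def holomorphic_on_def)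
  moreover obtain M where "\<And>y. norm (g y) \<le> M" using C_supp_bounded[OF assms(2,3)] by blast
  then have "bounded (range F)" by (auto simp: bounded_iff F_def)
  ultimately have "F constant_on UNIV" by (rule Liouville_theorem)
  then have F_const: "F \<zeta> = F 0" for \<zeta> unfolding constant_on_def by (metis UNIV_I)
  \<comment> \<open>\<open>a\<close> and \<open>b\<close> may be linearly dependent, but one of them
    is nonzero, and a single direction that leads away from \<open>x\<close> is enough.\<close>
  obtain \<xi> where \<xi>: "l \<xi> \<noteq> 0"
  proof (cases "a = 0")
    case True
    have "w = 0" if "b = 0"
      using True that by (simp add: a_def b_def vec_eq_iff complex_eq_iff)
    then have "l \<i> \<noteq> 0" using assms(4) by (auto simp: l_def)
    then show thesis by (rule that)
  next
    case False
    then have "l 1 \<noteq> 0" by (simp add: l_def)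
    then show thesis by (rule that)
  qed
  obtain R where R: "\<And>y. y \<in> \<Omega> \<Longrightarrow> norm y \<le> R"
    using compact_imp_bounded[OF assms(3)] unfolding bounded_iff by blast
  \<comment> \<open>This \<open>t\<close> carries the point out of the ball of radius
    \<open>R\<close>. The absolute value guards against a negative \<open>R\<close>, possible for
    empty \<open>\<Omega>\<close>.\<close>
  define t where "t = (\<bar>R\<bar> + 1 + norm x) / norm (l \<xi>)"
  have "l (of_real t * \<xi>) = t *\<^sub>R l \<xi>" by (simp add: l_def scaleR_add_right)
  then have "norm (l (of_real t * \<xi>)) = \<bar>R\<bar> + 1 + norm x" using \<xi> by (simp add: t_def)
  then have "norm (x + l (of_real t * \<xi>)) > R"
    using norm_triangle_ineq2[of "l (of_real t * \<xi>)" "- x"] by (simp add: add.commute)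
  then have "F (of_real t * \<xi>) = 0"
    unfolding F_def using R by (intro C_supp_zero_outside[OF assms(2)]) fastforce
  then have "F 0 = 0" using F_const by metis
  then show "g x = 0" by (simp add: F_def l_def)
qed

section \<open>Differentiating the refinement equation\<close>

lemma ref_int_sum:
  assumes K: "compact K" and B: "linear B" and G: "\<And>i. i \<in> I \<Longrightarrow> continuous_on UNIV (G i)"
  shows "ref_int c K B (\<lambda>y. \<Sum>i\<in>I. a i * G i y) x = (\<Sum>i\<in>I. a i * ref_int c K B (G i) x)"
proof -
  have int: "integrable lborel (\<lambda>u. indicator K u *\<^sub>R G i (B (x - u)))" if "i \<in> I" for i
    using set_integrable_compact[OF K continuous_on_linear_compose[OF B G[OF that]]]
    by (simp add: set_integrable_def)
  have "(LINT u:K|lborel. (\<Sum>i\<in>I. a i * G i (B (x - u))))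
      = (LINT u|lborel. (\<Sum>i\<in>I. a i * (indicator K u *\<^sub>R G i (B (x - u)))))"
    by (simp add: set_lebesgue_integral_def scaleR_sum_right)
  also have "\<dots> = (\<Sum>i\<in>I. LINT u|lborel. a i * (indicator K u *\<^sub>R G i (B (x - u))))"
    by (intro Bochner_Integration.integral_sum integrable_mult_right int)
  also have "\<dots> = (\<Sum>i\<in>I. a i * (LINT u:K|lborel. G i (B (x - u))))"
    by (simp only: set_lebesgue_integral_def integral_mult_right_zero)
  finally show ?thesis
    by (simp add: ref_int_def sum_distrib_left mult_ac)
qed

lemma C1_bounded_Lipschitz:
  fixes g :: "real^'n \<Rightarrow> complex"
  assumes "C1 g" "\<And>i x. norm (partial_deriv i g x) \<le> D"
  shows "norm (g (x + v) - g x) \<le> (real CARD('n) * D) * norm v"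
proof -
  have "norm (g (x + v) - g x) \<le> (real CARD('n) * D) * norm (x + v - x)"
  proof (rule differentiable_bound[of UNIV])
    fix y
    show "(g has_derivative (\<lambda>h. dir_deriv h g y)) (at y within UNIV)"
      using C1_has_derivative[OF assms(1)] by simp
    show "onorm (\<lambda>h. dir_deriv h g y) \<le> real CARD('n) * D"
    proof (rule onorm_le)
      fix h :: "real^'n"
      have "norm (dir_deriv h g y) \<le> (\<Sum>i\<in>(UNIV::'n set). norm h * D)"
        unfolding dir_deriv_def
        by (intro sum_norm_le) (auto intro!: mult_mono component_le_norm_cart assms(2))
      then show "norm (dir_deriv h g y) \<le> (real CARD('n) * D) * norm h" by (simp add: mult_ac)
    qed
  qed auto
  then show ?thesis by simp
qed

text \<open>Difference quotients pass under the integral by dominated convergence, and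
  \<open>B\<close> turns the direction \<open>w\<close> into \<open>B w\<close>. The derivative on
  the left is assumed to exist, so quotients along one null sequence determine it.\<close>

lemma ref_int_dir_deriv:
  fixes g :: "real^'n \<Rightarrow> complex"
  assumes K: "compact K" and B: "linear B"
    and g: "C1 g" "\<And>i x. norm (partial_deriv i g x) \<le> D"
    and der: "((\<lambda>s. ref_int c K B g (x + s *\<^sub>R w)) has_vector_derivative l) (at 0)"
  shows "l = ref_int c K B (dir_deriv (B w) g) x"
proof -
  define y where "y u = B (x - u)" for u
  define s where "s n = 1 / real (Suc n)" for n
  have s: "s n > 0" for n by (simp add: s_def)
  have s0: "s \<longlonglongrightarrow> 0"
    using LIMSEQ_inverse_real_of_nat by (simp add: s_def[abs_def] inverse_eq_divide)
  have at0: "filterlim s (at 0) sequentially"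
    unfolding filterlim_at using s0 s by (auto intro!: always_eventually simp: less_le)
  have cont_g: "continuous_on UNIV g"
    by (intro continuous_at_imp_continuous_on ballI has_derivative_continuous[OF C1_has_derivative[OF g(1)]])
  have quot: "(\<lambda>n. (1 / s n) *\<^sub>R (\<phi> (s n) - \<phi> 0)) \<longlonglongrightarrow> d"
    if "(\<phi> has_vector_derivative d) (at 0)" for \<phi> :: "real \<Rightarrow> complex" and d
  proof -
    have "((\<lambda>h. norm (\<phi> h - \<phi> 0 - h *\<^sub>R d) / norm h) \<longlongrightarrow> 0) (at 0)"
      using that unfolding has_vector_derivative_def has_derivative_iff_norm by simp
    from filterlim_compose[OF this at0]
    have "(\<lambda>n. norm (\<phi> (s n) - \<phi> 0 - s n *\<^sub>R d) / norm (s n)) \<longlonglongrightarrow> 0" .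
    moreover have "norm (\<phi> (s n) - \<phi> 0 - s n *\<^sub>R d) / norm (s n)
        = norm ((1 / s n) *\<^sub>R (\<phi> (s n) - \<phi> 0) - d)" for n
    proof -
      have "(1 / s n) *\<^sub>R (\<phi> (s n) - \<phi> 0) - d = (1 / s n) *\<^sub>R (\<phi> (s n) - \<phi> 0 - s n *\<^sub>R d)"
        using s[of n] by (simp add: scaleR_right_diff_distrib)
      then show ?thesis by simp
    qed
    ultimately have "(\<lambda>n. norm ((1 / s n) *\<^sub>R (\<phi> (s n) - \<phi> 0) - d)) \<longlonglongrightarrow> 0" by simp
    then show ?thesis by (rule LIM_zero_cancel[OF tendsto_norm_zero_cancel])
  qed
  have shift: "B (x + s n *\<^sub>R w - u) = y u + s n *\<^sub>R B w" for n u
    by (simp add: y_def linear_diff[OF B] linear_add[OF B] linear_cmul[OF B])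
  have C: "continuous_on UNIV (\<lambda>u. F (y u))" if "continuous_on UNIV F" for F :: "real^'n \<Rightarrow> complex"
    unfolding y_def by (rule continuous_on_linear_compose[OF B that])
  have C': "continuous_on UNIV (\<lambda>u. g (y u + v))" for v
    by (rule C[of "\<lambda>z. g (z + v)"]) (intro continuous_on_compose_UNIV[OF cont_g] continuous_intros)
  have lim: "(\<lambda>n. LINT u|lborel. indicator K u *\<^sub>R ((1 / s n) *\<^sub>R (g (y u + s n *\<^sub>R B w) - g (y u))))
      \<longlonglongrightarrow> (LINT u|lborel. indicator K u *\<^sub>R dir_deriv (B w) g (y u))"
  proof (rule integral_dominated_convergence)
    \<comment> \<open>The Lipschitz bound of \<open>g\<close> dominates all quotients at once, since
      the step length cancels.\<close>
    let ?D = "real CARD('n) * D * norm (B w)"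
    show "integrable lborel (\<lambda>u. indicator K u *\<^sub>R ?D)"
      using K by (intro borel_integrable_compact continuous_intros)
    show "(\<lambda>u. indicator K u *\<^sub>R dir_deriv (B w) g (y u)) \<in> borel_measurable lborel"
      by (rule borel_measurable_integrable[OF borel_integrable_compact[OF K
            continuous_on_subset[OF C[OF C1_continuous_dir_deriv[OF g(1)]]]]]) simp
    fix n
    have "continuous_on UNIV (\<lambda>u. (1 / s n) *\<^sub>R (g (y u + s n *\<^sub>R B w) - g (y u)))"
      by (rule continuous_on_scaleR[OF continuous_on_const continuous_on_diff[OF C' C[OF cont_g]]])
    then have "continuous_on K (\<lambda>u. (1 / s n) *\<^sub>R (g (y u + s n *\<^sub>R B w) - g (y u)))"
      by (rule continuous_on_subset) simp
    from borel_integrable_compact[OF K this]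
    show "(\<lambda>u. indicator K u *\<^sub>R ((1 / s n) *\<^sub>R (g (y u + s n *\<^sub>R B w) - g (y u)))) \<in> borel_measurable lborel"
      by (rule borel_measurable_integrable)
    have "norm (indicator K u *\<^sub>R ((1 / s n) *\<^sub>R (g (y u + s n *\<^sub>R B w) - g (y u)))) \<le> indicator K u *\<^sub>R ?D"
      for u
    proof -
      have "norm (g (y u + s n *\<^sub>R B w) - g (y u)) \<le> s n * ?D"
        using C1_bounded_Lipschitz[OF g, of "y u" "s n *\<^sub>R B w"] s[of n] by (simp add: mult_ac)
      then have "norm ((1 / s n) *\<^sub>R (g (y u + s n *\<^sub>R B w) - g (y u))) \<le> ?D"
        using s[of n] by (simp add: pos_divide_le_eq mult.commute)
      then show ?thesis by (cases "u \<in> K") simp_all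
    qed
    then show "AE u in lborel. norm (indicator K u *\<^sub>R ((1 / s n) *\<^sub>R (g (y u + s n *\<^sub>R B w) - g (y u))))
        \<le> indicator K u *\<^sub>R ?D" by simp
  next
    have "(\<lambda>n. (1 / s n) *\<^sub>R (g (y u + s n *\<^sub>R B w) - g (y u))) \<longlonglongrightarrow> dir_deriv (B w) g (y u)" for u
      using quot[OF has_derivative_line[of g "\<lambda>h. dir_deriv h g (y u)" "y u" 0 "B w"]]
        C1_has_derivative[OF g(1)] by simp
    then show "AE u in lborel. (\<lambda>n. indicator K u *\<^sub>R ((1 / s n) *\<^sub>R (g (y u + s n *\<^sub>R B w) - g (y u))))
        \<longlonglongrightarrow> indicator K u *\<^sub>R dir_deriv (B w) g (y u)"
      by (intro always_eventually allI tendsto_scaleR tendsto_const)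
  qed
  have quot_eq: "c * (LINT u|lborel. indicator K u *\<^sub>R ((1 / s n) *\<^sub>R (g (y u + s n *\<^sub>R B w) - g (y u))))
      = (1 / s n) *\<^sub>R (ref_int c K B g (x + s n *\<^sub>R w) - ref_int c K B g (x + 0 *\<^sub>R w))" for n
  proof -
    have "ref_int c K B g (x + s n *\<^sub>R w) = c * (LINT u:K|lborel. g (y u + s n *\<^sub>R B w))"
      by (simp add: ref_int_def shift)
    moreover have "ref_int c K B g (x + 0 *\<^sub>R w) = c * (LINT u:K|lborel. g (y u))"
      by (simp add: ref_int_def y_def)
    moreover have "(LINT u:K|lborel. g (y u + s n *\<^sub>R B w) - g (y u))
        = (LINT u:K|lborel. g (y u + s n *\<^sub>R B w)) - (LINT u:K|lborel. g (y u))"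
      by (intro set_integral_diff set_integrable_compact K C' C cont_g)
    moreover have "(LINT u|lborel. indicator K u *\<^sub>R ((1 / s n) *\<^sub>R (g (y u + s n *\<^sub>R B w) - g (y u))))
        = (1 / s n) *\<^sub>R (LINT u:K|lborel. g (y u + s n *\<^sub>R B w) - g (y u))"
      unfolding set_lebesgue_integral_def integral_scaleR_right[symmetric]
      by (intro Bochner_Integration.integral_cong) auto
    ultimately show ?thesis by (simp add: right_diff_distrib)
  qed
  note tendsto_mult_left[OF lim, of c, unfolded quot_eq]
  from LIMSEQ_unique[OF quot[OF der] this] show ?thesis
    by (simp add: ref_int_def set_lebesgue_integral_def y_def)
qed

definition is_eigen :: "real^'n^'n \<Rightarrow> (real^'n) set \<Rightarrow> complex \<Rightarrow> (real^'n \<Rightarrow> complex) \<Rightarrow> bool" where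
  "is_eigen A \<Omega> z g \<longleftrightarrow> g \<in> C_supp \<Omega> \<and> refinement_op A \<Omega> g = (\<lambda>x. z * g x)"

section \<open>Regularity and derivatives of eigenfunctions\<close>

locale refinement =
  fixes A :: "real^'n^'n" and \<Omega> :: "(real^'n) set"
  assumes invertible: "invertible A" and compact: "compact \<Omega>" and nonempty: "\<Omega> \<noteq> {}"
begin

abbreviation "K \<equiv> Omega_Q A \<Omega>"
abbreviation "B \<equiv> (*v) (matrix_inv A)"
abbreviation "c \<equiv> complex_of_real (1 / (\<bar>det A\<bar> * measure lborel K))"

text \<open>\<open>Omega_Q A \<Omega>\<close> is the intersection of the compact translates of
  \<open>\<Omega>\<close> by \<open>- (A *v x)\<close> over \<open>x \<in> \<Omega>\<close>; the
  family is nonempty because \<open>\<Omega>\<close> is.\<close>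

lemma compact_K: "compact K"
proof -
  have "(u \<in> (+) (- a) ` \<Omega>) = (a + u \<in> \<Omega>)" for u a
    by (auto simp: image_iff intro!: bexI[of _ "a + u"])
  then have "K = (\<Inter>x\<in>\<Omega>. (+) (- (A *v x)) ` \<Omega>)"
    by (auto simp only: Omega_Q_def INT_iff mem_Collect_eq image_subset_iff set_eq_iff)
  moreover have "compact (\<Inter>x\<in>\<Omega>. (+) (- (A *v x)) ` \<Omega>)"
    using nonempty by (intro compact_Inter) (auto simp only: image_is_empty intro: compact_translation compact)
  ultimately show ?thesis by simp
qed

lemma matrix_inv_mult: "matrix_inv A ** A = mat 1"
  using invertible unfolding invertible_def matrix_inv_def
  by (rule someI2_ex) simp

lemma refinement_op_eq: "refinement_op A \<Omega> g = ref_int c K B g"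
  by (intro ext) (simp only: refinement_op_def ref_int_def scaleR_conv_of_real)

text \<open>Dividing by \<open>z\<close> makes \<open>g\<close> a fixed point of the operator with
  constant \<open>c / z\<close>, to which the regularity result applies.\<close>

lemma eigen_C1:
  assumes "is_eigen A \<Omega> z g" "z \<noteq> 0"
  shows "C1 g"
proof -
  obtain M where M: "\<And>x. norm (g x) \<le> M"
    using assms(1) C_supp_bounded[OF _ compact] by (auto simp: is_eigen_def)
  have cont: "continuous_on UNIV g" using assms(1) by (simp add: is_eigen_def C_supp_def)
  have "g x = ref_int (c / z) K B g x" for x
  proof -
    have "ref_int c K B g x = z * g x"
      using assms(1) by (simp add: is_eigen_def refinement_op_eq fun_eq_iff)
    moreover have "ref_int (c / z) K B g x = ref_int c K B g x / z"
      by (simp only: ref_int_def times_divide_eq_left)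
    ultimately show ?thesis using assms(2) by simp
  qed
  then have "g = ref_int (c / z) K B g" by blast
  from ref_int_fixed_point_directional_derivative[OF compact_K matrix_vector_mul_linear cont M this]
  show ?thesis by (intro C1_I)
qed

text \<open>Differentiating both sides of the eigenvalue equation in a real direction
  \<open>A *v v\<close> produces the direction \<open>v\<close> under the integral, as
  \<open>B\<close> inverts \<open>A\<close>. The complex case follows by linearity in
  \<open>w\<close>.\<close>

lemma refinement_op_cdir_deriv:
  assumes g: "is_eigen A \<Omega> z g" "z \<noteq> 0"
  shows "refinement_op A \<Omega> (cdir_deriv w g) x = z * cdir_deriv (cmat A *v w) g x"
proof -
  have C1: "C1 g" by (rule eigen_C1[OF g])
  have "cdir_deriv (axis i 1) g = partial_deriv i g" for i
  proof
    fix y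
    have "cdir_deriv (axis i 1) g y = (\<Sum>k\<in>UNIV. if k = i then partial_deriv i g y else 0)"
      unfolding cdir_deriv_def axis_def by (intro sum.cong) auto
    then show "cdir_deriv (axis i 1) g y = partial_deriv i g y" by simp
  qed
  then have supp: "partial_deriv i g \<in> C_supp \<Omega>" for i
    using cdir_deriv_in_C_supp[OF C1, of \<Omega> "axis i 1"] g(1) by (simp add: is_eigen_def)
  then have "\<forall>i. \<exists>M\<ge>0. \<forall>x. norm (partial_deriv i g x) \<le> M" using C_supp_bounded[OF _ compact] by blast
  then obtain D where D: "\<And>i x. norm (partial_deriv i g x) \<le> D i" by metis
  have D': "norm (partial_deriv i g x) \<le> Max (range D)" for i x
    using D[of i x] by (rule order_trans) simp
  have eq: "ref_int c K B g = (\<lambda>x. z * g x)"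
    using g(1) by (simp add: is_eigen_def refinement_op_eq)
  have BA: "B (A *v v) = v" for v
    by (simp add: matrix_vector_mul_assoc matrix_inv_mult)
  have partial: "ref_int c K B (partial_deriv i g) x = z * (\<Sum>k\<in>UNIV. A $ k $ i *\<^sub>R partial_deriv k g x)" for i
  proof -
    \<comment> \<open>The direction is the image of the axis under \<open>A\<close>, so that the
      plain \<open>i\<close>-th partial derivative appears under the integral.\<close>
    have "((\<lambda>s. g (x + s *\<^sub>R (A *v axis i 1))) has_vector_derivative dir_deriv (A *v axis i 1) g x) (at 0)"
      by (rule has_derivative_line) (use C1_has_derivative[OF C1] in simp)
    then have "((\<lambda>s. ref_int c K B g (x + s *\<^sub>R (A *v axis i 1))) has_vector_derivative
        z * dir_deriv (A *v axis i 1) g x) (at 0)"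
      unfolding eq by (rule has_vector_derivative_mult_right)
    from ref_int_dir_deriv[OF compact_K matrix_vector_mul_linear C1 D' this]
    have "z * dir_deriv (A *v axis i 1) g x = ref_int c K B (partial_deriv i g) x"
      by (simp add: BA dir_deriv_axis[abs_def])
    moreover have "(A *v axis i 1) $ k = A $ k $ i" for k
      by (simp add: matrix_vector_mult_basis column_def)
    ultimately show ?thesis by (simp add: dir_deriv_def)
  qed
  have "refinement_op A \<Omega> (cdir_deriv w g) x = (\<Sum>i\<in>UNIV. w $ i * ref_int c K B (partial_deriv i g) x)"
    unfolding refinement_op_eq cdir_deriv_def[abs_def]
    by (rule ref_int_sum[OF compact_K matrix_vector_mul_linear]) (use C1 in \<open>simp add: C1_def\<close>)
  also have "\<dots> = (\<Sum>i\<in>UNIV. \<Sum>k\<in>UNIV. z * (cmat A $ k $ i * w $ i * partial_deriv k g x))"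
    unfolding partial
    by (simp add: sum_distrib_left cmat_def map_matrix_def scaleR_conv_of_real mult_ac)
  also have "\<dots> = (\<Sum>k\<in>UNIV. \<Sum>i\<in>UNIV. z * (cmat A $ k $ i * w $ i * partial_deriv k g x))"
    by (rule sum.swap)
  also have "\<dots> = z * cdir_deriv (cmat A *v w) g x"
    by (simp add: cdir_deriv_def matrix_vector_mult_def sum_distrib_left sum_distrib_right)
  finally show ?thesis .
qed

lemma eigen_cdir_deriv:
  assumes g: "is_eigen A \<Omega> z g" "z \<noteq> 0" and w: "cmat A *v w = \<alpha> *s w"
  shows "is_eigen A \<Omega> (\<alpha> * z) (cdir_deriv w g)"
proof -
  have "cdir_deriv (\<alpha> *s w) g x = \<alpha> * cdir_deriv w g x" for x
    by (simp add: cdir_deriv_def sum_distrib_left mult_ac)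
  then show ?thesis
    using refinement_op_cdir_deriv[OF g, of w] cdir_deriv_in_C_supp[OF eigen_C1[OF g]] g(1)
    by (auto simp: is_eigen_def w mult_ac)
qed

end

section \<open>Eigenbases\<close>

text \<open>Duality says that the matrix with rows \<open>vd i\<close> is a left inverse of the one
  with columns \<open>v j\<close>. For square matrices it is then a right inverse, which is the
  expansion.\<close>

lemma dual_basis_expansion:
  fixes v vd :: "'n::finite \<Rightarrow> complex^'n"
  assumes "is_dual_basis vd v"
  shows "w $ k = (\<Sum>j\<in>UNIV. bdot w (v j) * vd j $ k)"
proof -
  define W :: "complex^'n^'n" where "W = (\<chi> i k. vd i $ k)"
  define V :: "complex^'n^'n" where "V = (\<chi> k j. v j $ k)"
  have "W ** V = mat 1"
    using assms by (simp add: W_def V_def matrix_matrix_mult_def mat_def vec_eq_iff is_dual_basis_def bdot_def)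
  then have "V ** W = mat 1" by (simp only: matrix_left_right_inverse)
  then have VW: "(\<Sum>j\<in>UNIV. v j $ i * vd j $ k) = (if i = k then 1 else 0)" for i
    by (simp add: W_def V_def matrix_matrix_mult_def mat_def vec_eq_iff)
  have "(\<Sum>j\<in>UNIV. bdot w (v j) * vd j $ k) = (\<Sum>j\<in>UNIV. \<Sum>i\<in>UNIV. w $ i * (v j $ i * vd j $ k))"
    by (simp add: bdot_def sum_distrib_right mult.assoc)
  also have "\<dots> = (\<Sum>i\<in>UNIV. \<Sum>j\<in>UNIV. w $ i * (v j $ i * vd j $ k))"
    by (rule sum.swap)
  also have "\<dots> = (\<Sum>i\<in>UNIV. w $ i * (if i = k then 1 else 0))"
    by (simp only: VW sum_distrib_left[symmetric])
  also have "\<dots> = w $ k" by (simp add: if_distrib cong: if_cong)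
  finally show ?thesis by simp
qed

lemma bdot_transpose: "bdot (cmat A *v x) y = bdot x (cmat (transpose A) *v y)"
proof -
  have "bdot (cmat A *v x) y = (\<Sum>i\<in>UNIV. \<Sum>k\<in>UNIV. complex_of_real (A $ i $ k) * x $ k * y $ i)"
    by (simp add: bdot_def matrix_vector_mult_def cmat_def map_matrix_def sum_distrib_right)
  also have "\<dots> = (\<Sum>k\<in>UNIV. \<Sum>i\<in>UNIV. complex_of_real (A $ i $ k) * x $ k * y $ i)"
    by (rule sum.swap)
  also have "\<dots> = bdot x (cmat (transpose A) *v y)"
    by (simp add: bdot_def matrix_vector_mult_def cmat_def map_matrix_def transpose_def
        sum_distrib_left mult_ac)
  finally show ?thesis .
qed

lemma bdot_cmult: "bdot x (a *s y) = a * bdot x y"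
  by (simp add: bdot_def sum_distrib_left mult_ac)

text \<open>Expanded in the dual basis, \<open>cmat A *v vd j\<close> has the coefficients
  \<open>bdot (vd j) (\<alpha> i *s v i)\<close>, of which only \<open>i = j\<close>
  survives.\<close>

lemma dual_basis_eigenvector:
  fixes v vd :: "'n::finite \<Rightarrow> complex^'n"
  assumes "is_dual_basis vd v" "\<And>j. cmat (transpose A) *v v j = \<alpha> j *s v j"
  shows "cmat A *v vd j = \<alpha> j *s vd j"
proof -
  have "(cmat A *v vd j) $ k = \<alpha> j * vd j $ k" for k
  proof -
    have "(cmat A *v vd j) $ k = (\<Sum>i\<in>UNIV. (if j = i then \<alpha> i * vd i $ k else 0))"
      unfolding dual_basis_expansion[OF assms(1), of "cmat A *v vd j" k]
      using assms by (intro sum.cong) (auto simp: bdot_transpose bdot_cmult is_dual_basis_def)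
    then show ?thesis by simp
  qed
  then show ?thesis by (simp add: vec_eq_iff)
qed

text \<open>A real left inverse of \<open>A\<close> remains a left inverse over the complex numbers,
  so no nonzero vector is sent to 0.\<close>

lemma cmat_eigenvalue_nonzero:
  fixes A :: "real^'n^'n"
  assumes "invertible A" "cmat A *v w = a *s w" "w \<noteq> 0"
  shows "a \<noteq> 0"
proof
  assume "a = 0"
  obtain B where "B ** A = mat 1" using assms(1) by (auto simp: invertible_def)
  then have "cmat (B ** A) = mat 1"
    by (simp add: cmat_def map_matrix_def mat_def vec_eq_iff)
  moreover have "cmat (B ** A) = cmat B ** cmat A"
    by (simp add: cmat_def map_matrix_def matrix_matrix_mult_def vec_eq_iff)
  ultimately have "w = cmat B *v (cmat A *v w)"
    by (simp add: matrix_vector_mul_assoc)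
  then have "w = 0" using assms(2) \<open>a = 0\<close> by simp
  then show False using assms(3) by simp
qed

text \<open>Each point of the physical projection is \<open>Q *v x\<close> for some \<open>x\<close>
  in it, so its star lies in the range of \<open>A\<close>. The range is a closed subspace
  containing a dense set, hence everything.\<close>

lemma is_star_of_invertible:
  fixes Lt :: "((real^'m) \<times> (real^'n)) set"
  assumes "cut_and_project_scheme Lt" "(*v) Q ` phys Lt = phys Lt" "is_star_of Lt A Q"
  shows "invertible A"
proof -
  have inj: "inj_on fst Lt" and dense: "closure (snd ` Lt) = UNIV"
    using assms(1) by (auto simp: cut_and_project_scheme_def)
  have "snd ` Lt \<subseteq> range ((*v) A)"
  proof
    fix y assume "y \<in> snd ` Lt"
    then obtain p where p: "p \<in> Lt" "y = snd p" by blast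
    then have "fst p \<in> (*v) Q ` phys Lt" unfolding assms(2) by (simp add: phys_def)
    then obtain x where x: "x \<in> phys Lt" "fst p = Q *v x" by blast
    have "y = star Lt (fst p)" using p inj by (simp add: star_def)
    then show "y \<in> range ((*v) A)" using assms(3) x by (simp add: is_star_of_def)
  qed
  moreover have "closed (range ((*v) A))"
    by (intro closed_subspace linear_subspace_image matrix_vector_mul_linear subspace_UNIV)
  ultimately have "surj ((*v) A)" using dense closure_minimal by blast
  then show ?thesis
    by (metis invertible_right_inverse matrix_right_invertible_surjective)
qed

text \<open>The span of the eigenfunctions with nonzero eigenvalue. A coordinate derivative of an
  eigenfunction need not be an eigenfunction, but it stays in this span, so differentiation can be
  iterated.\<close>

inductive_set eigen_span :: "real^'n^'n \<Rightarrow> (real^'n) set \<Rightarrow> (real^'n \<Rightarrow> complex) set" for A \<Omega> where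
  eigen: "is_eigen A \<Omega> z g \<Longrightarrow> z \<noteq> 0 \<Longrightarrow> g \<in> eigen_span A \<Omega>"
| zero: "(\<lambda>x. 0) \<in> eigen_span A \<Omega>"
| add: "g \<in> eigen_span A \<Omega> \<Longrightarrow> h \<in> eigen_span A \<Omega> \<Longrightarrow> (\<lambda>x. g x + h x) \<in> eigen_span A \<Omega>"
| cmult: "g \<in> eigen_span A \<Omega> \<Longrightarrow> (\<lambda>x. a * g x) \<in> eigen_span A \<Omega>"

lemma eigen_span_sum:
  "finite I \<Longrightarrow> (\<And>i. i \<in> I \<Longrightarrow> g i \<in> eigen_span A \<Omega>) \<Longrightarrow> (\<lambda>x. \<Sum>i\<in>I. g i x) \<in> eigen_span A \<Omega>"
  by (induction I rule: finite_induct) (auto intro: eigen_span.zero eigen_span.add)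

section \<open>Smoothness and nonvanishing of iterated derivatives\<close>

locale refinement_eigenbasis = refinement A \<Omega>
  for A :: "real^'n^'n" and \<Omega> +
  fixes v vd :: "'n \<Rightarrow> complex^'n" and \<alpha> :: "'n \<Rightarrow> complex"
  assumes eigenvector: "\<And>j. cmat (transpose A) *v v j = \<alpha> j *s v j"
    and dual: "is_dual_basis vd v"
begin

lemma dual_nonzero: "vd j \<noteq> 0"
  using dual by (auto simp: is_dual_basis_def bdot_def dest!: spec[of _ j])

lemma dual_eigenvector: "cmat A *v vd j = \<alpha> j *s vd j"
  by (rule dual_basis_eigenvector[OF dual eigenvector])

lemma eigenvalue_nonzero: "\<alpha> j \<noteq> 0"
  by (rule cmat_eigenvalue_nonzero[OF invertible dual_eigenvector dual_nonzero])

text \<open>Since \<open>axis i 1\<close> is the combination of the \<open>vd j\<close> with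
  coefficients \<open>v j $ i\<close>, the \<open>i\<close>-th partial derivative is the same
  combination of the \<open>cdir_deriv (vd j)\<close>, each of which preserves
  eigenfunctions.\<close>

lemma eigen_span_C1:
  "g \<in> eigen_span A \<Omega> \<Longrightarrow> C1 g \<and> (\<forall>i. partial_deriv i g \<in> eigen_span A \<Omega>)"
proof (induction rule: eigen_span.induct)
  case (eigen z g)
  have "partial_deriv i g \<in> eigen_span A \<Omega>" for i
  proof -
    have "cdir_deriv (vd j) g \<in> eigen_span A \<Omega>" for j
      by (rule eigen_span.eigen[OF eigen_cdir_deriv[OF eigen dual_eigenvector]])
        (simp add: eigen eigenvalue_nonzero)
    then have "(\<lambda>x. \<Sum>j\<in>UNIV. v j $ i * cdir_deriv (vd j) g x) \<in> eigen_span A \<Omega>"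
      by (intro eigen_span_sum eigen_span.cmult) auto
    moreover have "(\<Sum>j\<in>UNIV. v j $ i * cdir_deriv (vd j) g x) = partial_deriv i g x" for x
    proof -
      have bd: "bdot (axis i 1) (v j) = v j $ i" for j
        by (simp add: bdot_def axis_def if_distrib[of "\<lambda>a. a * _"] cong: if_cong)
      have "(\<Sum>j\<in>UNIV. v j $ i * cdir_deriv (vd j) g x)
          = (\<Sum>j\<in>UNIV. \<Sum>k\<in>UNIV. (v j $ i * vd j $ k) * partial_deriv k g x)"
        by (simp add: cdir_deriv_def sum_distrib_left mult.assoc)
      also have "\<dots> = (\<Sum>k\<in>UNIV. \<Sum>j\<in>UNIV. (v j $ i * vd j $ k) * partial_deriv k g x)"
        by (rule sum.swap)
      also have "\<dots> = (\<Sum>k\<in>UNIV. axis i 1 $ k * partial_deriv k g x)"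
        by (simp only: dual_basis_expansion[OF dual, of "axis i 1"] bd sum_distrib_right)
      also have "\<dots> = partial_deriv i g x"
        by (simp add: axis_def if_distrib[of "\<lambda>a. a * _"] cong: if_cong)
      finally show ?thesis .
    qed
    ultimately show ?thesis by simp
  qed
  then show ?case using eigen_C1[OF eigen] by blast
next
  case zero
  have pd: "partial_deriv i (\<lambda>x. 0) = (\<lambda>x. 0)" for i :: 'n
    by (intro ext partial_deriv_eq[where g' = "\<lambda>_. 0"]) simp
  have "C1 (\<lambda>x::real^'n. 0)" by (simp add: C1_def pd dir_deriv_def)
  then show ?case by (simp add: pd eigen_span.zero)
next
  case (add g h)
  then show ?case using C1_add[of g h] by (auto intro: eigen_span.add)
next
  case (cmult g a)
  then show ?case using C1_cmult[of g] by (auto intro: eigen_span.cmult)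
qed

lemma C_infinity_eigen_span:
  assumes "g \<in> eigen_span A \<Omega>"
  shows "C_infinity g"
proof -
  have "foldr partial_deriv is g \<in> eigen_span A \<Omega>" for "is"
    by (induction "is") (use assms eigen_span_C1 in auto)
  then show ?thesis
    unfolding C_infinity_def using eigen_span_C1 C1_has_derivative differentiableI by blast
qed

text \<open>Three facts are carried along: the eigenvalue stays nonzero as \<open>\<alpha> j\<close>
  is, hence the next derivative exists, and it cannot vanish by
  \<open>cdir_deriv_nonzero\<close>.\<close>

lemma cdir_deriv_pow_eigen:
  assumes "is_eigen A \<Omega> z g" "z \<noteq> 0" "g \<noteq> (\<lambda>x. 0)"
  shows "is_eigen A \<Omega> (\<alpha> j ^ b * z) ((cdir_deriv (vd j) ^^ b) g) \<and>
         (cdir_deriv (vd j) ^^ b) g \<noteq> (\<lambda>x. 0)"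
proof (induction b)
  case (Suc b)
  let ?g = "(cdir_deriv (vd j) ^^ b) g"
  have z: "\<alpha> j ^ b * z \<noteq> 0" using assms(2) eigenvalue_nonzero by simp
  have eig: "is_eigen A \<Omega> (\<alpha> j ^ b * z) ?g" using Suc by blast
  have "cdir_deriv (vd j) ?g \<noteq> (\<lambda>x. 0)"
    using cdir_deriv_nonzero[OF eigen_C1[OF eig z] _ compact dual_nonzero] eig Suc
    by (auto simp: is_eigen_def)
  then show ?case
    using eigen_cdir_deriv[OF eig z dual_eigenvector[of j]] by (simp add: mult.assoc)
qed (use assms in simp)

text \<open>Distinctness of \<open>js\<close> makes the product over \<open>set js\<close> contain
  one factor for each entry of the list.\<close>

lemma multi_deriv_eigen:
  assumes "is_eigen A \<Omega> z g" "z \<noteq> 0" "g \<noteq> (\<lambda>x. 0)" "distinct js"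
  shows "is_eigen A \<Omega> ((\<Prod>j\<in>set js. \<alpha> j ^ b j) * z) (multi_deriv vd js b g) \<and>
         multi_deriv vd js b g \<noteq> (\<lambda>x. 0)"
  using assms(4)
proof (induction js)
  case Nil
  then show ?case using assms by (simp add: multi_deriv_def)
next
  case (Cons j js)
  have "(\<Prod>j\<in>set js. \<alpha> j ^ b j) * z \<noteq> 0"
    using assms(2) eigenvalue_nonzero by simp
  from cdir_deriv_pow_eigen[OF _ this, of "multi_deriv vd js b g" j "b j"] Cons
  show ?case by (simp add: multi_deriv_def mult.assoc)
qed

end

theorem proposition3:
  fixes Lt :: "((real^'m) \<times> (real^'n)) set"
    and \<Omega> :: "(real^'n) set"
    and Q :: "real^'m^'m"
    and A :: "real^'n^'n"
    and f :: "real^'n \<Rightarrow> complex"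
    and v vd :: "'n \<Rightarrow> complex^'n"
    and \<alpha> :: "'n \<Rightarrow> complex"
    and b :: "'n \<Rightarrow> nat"
    and js :: "'n list"
  assumes "cut_and_project_scheme Lt"
    and "model_set_window \<Omega>"
    and "0 \<in> Lambda Lt \<Omega>"
    and "0 \<in> interior \<Omega>"
    and "linear_similarity Q"
    and "(*v) Q ` phys Lt = phys Lt"
    and "is_star_of Lt A Q"
    and "eigenvalues_in_unit_disc A"
    and "compatible A \<Omega>"
    and "frontier (Omega_Q A \<Omega>) \<in> null_sets lborel"
    and "is_invariant_density_function A \<Omega> f"
    and "is_cbasis v"
    and "\<And>j. cmat (transpose A) *v v j = \<alpha> j *s v j"
    and "is_dual_basis vd v"
    and "distinct js" and "set js = UNIV"
  shows "C_infinity f \<and>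
         refinement_eigenfunction A \<Omega> (\<Prod>j\<in>UNIV. \<alpha> j ^ b j) (multi_deriv vd js b f)"
proof -
  interpret refinement_eigenbasis A \<Omega> v vd \<alpha>
  proof unfold_locales
    show "invertible A" by (rule is_star_of_invertible[OF assms(1,6,7)])
    show "compact \<Omega>" using assms(2) by (simp add: model_set_window_def)
    show "\<Omega> \<noteq> {}" using assms(4) by auto
  qed (use assms(13,14) in auto)
  have f: "is_eigen A \<Omega> 1 f" and int: "(LINT u|lborel. f u) = 1"
    using assms(11) by (auto simp: is_invariant_density_function_def is_eigen_def)
  \<comment> \<open>The normalization of the integral excludes the zero function and so starts the
    nonvanishing induction.\<close>
  then have "f \<noteq> (\<lambda>x. 0)" by auto
  from multi_deriv_eigen[OF f _ this assms(15), of b]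
  have "refinement_eigenfunction A \<Omega> (\<Prod>j\<in>UNIV. \<alpha> j ^ b j) (multi_deriv vd js b f)"
    using assms(16) by (simp add: refinement_eigenfunction_def is_eigen_def)
  moreover have "C_infinity f"
    by (rule C_infinity_eigen_span[OF eigen_span.eigen[OF f]]) simp
  ultimately show ?thesis by blast
qed

end
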